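(* Suppose Algorithm SPG (described in the context) is run without termination, with $\mathcal{O}(z^{(0)})<\theta$, $\tau_1\tau_3\ge1$, and $$\mu^{(0)}L^{(0)}\ge\max\left\{6\lambda_2N_1N_0+\frac{2}{\eta}\left(N_2L_{\widetilde{\mathcal{H}}}+\lambda_1N_1N\right),\ 8\lambda_2+L_{\nabla\widetilde{\mathcal{H}}}\right\}.$$ Then (a) $\lim_{k\to\infty}\mu^{(k)}=0$; (b) the sequences $\{\mathcal{O}(z^{(k)})\}$ and $\{\widetilde{\mathcal{O}}(z^{(k)},\mu^{(k)})\}$ are convergent, and $\lim_{k\to\infty}\widetilde{\mathcal{O}}(z^{(k)},\mu^{(k)})=\lim_{k\to\infty}\mathcal{O}(z^{(k)})$.
   Context: Let $N,N_0,N_1$ be positive integers, $X=(x_1,\ldots,x_N)\in\mathbb{R}^{N_0\times N}$ a given data matrix, and $\lambda_1,\lambda_2,\beta>0$ given parameters. For a real vector $y$, $(y)_+=\max\{y,0\}$ componentwise; $e$ denotes the all-ones vector of $\mathbb{R}^{N_1}$. For a matrix $Y$, $\|Y\|_F$ is the Frobenius norm and $\|Y\|_1$ the maximum absolute column sum. The variable is $z=(\mathrm{vec}(W)^\top,b^\top,\mathrm{vec}(V)^\top)^\top\in\mathbb{R}^{N_2}$, $N_2=N_0N_1+N_1+N_0+N_1N$, where $W\in\mathbb{R}^{N_1\times N_0}$, $b=(b_1^\top,b_2^\top)^\top$ with $b_1\in\mathbb{R}^{N_1}$, $b_2\in\mathbb{R}^{N_0}$, $V=(v_1,\ldots,v_N)\in\mathbb{R}^{N_1\times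 N}$, and vec is columnwise vectorization. Define $\mathcal{F}(z)=\frac1N\sum_{n=1}^N\|(W^\top v_n+b_2)_+-x_n\|_2^2$, $\mathcal{R}(z)=\lambda_1\sum_{n=1}^N e^\top v_n+\lambda_2\|W\|_F^2$, $\mathcal{P}(z)=\beta\sum_{n=1}^N e^\top(v_n-(Wx_n+b_1)_+)$, $\mathcal{O}=\mathcal{F}+\mathcal{R}+\mathcal{P}$. Let $\Omega_2=\{z: v_n\ge (Wx_n+b_1)_+,\ n=1,\ldots,N\}$. Fix $\theta>\frac1N\|X\|_F^2$ and set $\alpha=\max\left\{\frac{\theta}{\lambda_1}+\sqrt{\frac{N_1N_0\theta}{\lambda_2}}\|X\|_1,\ \frac{\theta\sqrt{N_1N_0\theta}}{\lambda_1\sqrt{\lambda_2}}+\sqrt{N\theta}+\|X\|_1\right\}$, $\eta=\max\{\sqrt{N_1N_0\theta/\lambda_2},\ \theta/\lambda_1\}$. Let $\Omega_3=\{z:\|b\|_\infty\le\alpha\}$, $\mathcal{Z}=\Omega_2\cap\Omega_3$, $\Omega_\theta=\{z\in\Omega_2:\mathcal{O}(z)\le\theta\}$. Smoothing: for $y\in\mathbb{R}^m$, $\mu>0$, $\widetilde\sigma(y,\mu)\in\mathbb{R}^m$ has components $\widetilde\sigma_i(y,\mu)=0$ if $y_i<0$, $y_i^2/(2\mu)$ if $0\le y_i\le\mu$, $y_i-\mu/2$ if $y_i>\mu$. Define $\widetilde{\mathcal{F}}(z,\mu)=\frac1N\sum_{n=1}^N\|(W^\top v_n+b_2)_+\|_2^2+\frac1N\|X\|_F^2-\frac2N\sum_{n=1}^Nx_n^\top\widetilde\sigma(W^\top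 v_n+b_2,\mu)$, $\widetilde{\mathcal{P}}(z,\mu)=\beta\sum_{n=1}^Ne^\top(v_n-\widetilde\sigma(Wx_n+b_1,\mu))$, $\widetilde{\mathcal{H}}=\widetilde{\mathcal{F}}+\widetilde{\mathcal{P}}$, $\widetilde{\mathcal{O}}(z,\mu)=\widetilde{\mathcal{H}}(z,\mu)+\mathcal{R}(z)$. Let $L_{\widetilde{\mathcal{H}}}$ be a Lipschitz constant of $(z,\mu)\mapsto\mu\widetilde{\mathcal{H}}(z,\mu)$ over $(\Omega_\theta\cap\mathcal{Z})\times(0,1)$, and $L_{\nabla\widetilde{\mathcal{H}}}$ a Lipschitz constant of $(z,\mu)\mapsto\mu\nabla_z\widetilde{\mathcal{H}}(z,\mu)$ over $\{z:\|z\|_\infty\le\max\{\alpha,2\eta\}\}\times(0,1)$. Algorithm SPG: choose $z^{(0)}\in\mathcal{Z}$, $0<\mu^{(0)}<1$, $0<\tau_1<1$, $\tau_2>0$, $\tau_3\ge1$, $L^{(0)}\ge1$. For $k=0,1,2,\ldots$: let $z^{(k+1)}$ be the unique minimizer over $z\in\mathcal{Z}$ of $\langle\nabla_z\widetilde{\mathcal{H}}(z^{(k)},\mu^{(k)}),z-z^{(k)}\rangle+\mathcal{R}(z)+\frac{L^{(k)}}2\|z-z^{(k)}\|_2^2$; then set $(\mu^{(k+1)},L^{(k+1)})=(\mu^{(k)},L^{(k)})$ if $\widetilde{\mathcal{O}}(z^{(k+1)},\mu^{(k)})-\widetilde{\mathcal{O}}(z^{(k)},\mu^{(k)})<-\tau_2\mu^{(k)}/L^{(k)}$,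 and $(\mu^{(k+1)},L^{(k+1)})=(\tau_1\mu^{(k)},\tau_3L^{(k)})$ otherwise. *)

theory Defs
  imports "HOL-Analysis.Analysis"
begin

text \<open>
Conventions. All indices are 0-based. The data matrix X is a function
X j n (row j < N0, column n < N), i.e. x_n = (X 0 n, ..., X (N0-1) n).
The variable z in R^N2 is a function nat => real whose coordinates with
index >= N2 vanish (see supp). Its blocks are extracted according to
z = (vec W; b1; b2; vec V) with columnwise vectorization.
\<close>

definition pos :: "real \<Rightarrow> real" where
  "pos y = max y 0"

definition dimz :: "nat \<Rightarrow> nat \<Rightarrow> nat \<Rightarrow> nat" where
  "dimz N N0 N1 = N0 * N1 + N1 + N0 + N1 * N"

definition supp :: "nat \<Rightarrow> (nat \<Rightarrow> real) set" where
  "supp M = {z. \<forall>i\<ge>M. z i = 0}"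

definition Wm :: "nat \<Rightarrow> nat \<Rightarrow> (nat \<Rightarrow> real) \<Rightarrow> nat \<Rightarrow> nat \<Rightarrow> real" where
  "Wm N0 N1 z i j = z (j * N1 + i)"

definition b1v :: "nat \<Rightarrow> nat \<Rightarrow> (nat \<Rightarrow> real) \<Rightarrow> nat \<Rightarrow> real" where
  "b1v N0 N1 z i = z (N0 * N1 + i)"

definition b2v :: "nat \<Rightarrow> nat \<Rightarrow> (nat \<Rightarrow> real) \<Rightarrow> nat \<Rightarrow> real" where
  "b2v N0 N1 z j = z (N0 * N1 + N1 + j)"

definition Vm :: "nat \<Rightarrow> nat \<Rightarrow> (nat \<Rightarrow> real) \<Rightarrow> nat \<Rightarrow> nat \<Rightarrow> real" where
  "Vm N0 N1 z i n = z (N0 * N1 + N1 + N0 + n * N1 + i)"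

definition pre2 :: "nat \<Rightarrow> nat \<Rightarrow> (nat \<Rightarrow> real) \<Rightarrow> nat \<Rightarrow> nat \<Rightarrow> real" where
  "pre2 N0 N1 z j n = (\<Sum>i<N1. Wm N0 N1 z i j * Vm N0 N1 z i n) + b2v N0 N1 z j"

definition pre1 :: "nat \<Rightarrow> nat \<Rightarrow> (nat \<Rightarrow> nat \<Rightarrow> real) \<Rightarrow> (nat \<Rightarrow> real) \<Rightarrow> nat \<Rightarrow> nat \<Rightarrow> real" where
  "pre1 N0 N1 X z i n = (\<Sum>j<N0. Wm N0 N1 z i j * X j n) + b1v N0 N1 z i"

definition frob2 :: "nat \<Rightarrow> nat \<Rightarrow> (nat \<Rightarrow> nat \<Rightarrow> real) \<Rightarrow> real" where
  "frob2 N N0 X = (\<Sum>j<N0. \<Sum>n<N. (X j n)\<^sup>2)"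

definition norm1 :: "nat \<Rightarrow> nat \<Rightarrow> (nat \<Rightarrow> nat \<Rightarrow> real) \<Rightarrow> real" where
  "norm1 N N0 X = Max ((\<lambda>n. \<Sum>j<N0. \<bar>X j n\<bar>) ` {..<N})"

definition Ffun :: "nat \<Rightarrow> nat \<Rightarrow> nat \<Rightarrow> (nat \<Rightarrow> nat \<Rightarrow> real) \<Rightarrow> (nat \<Rightarrow> real) \<Rightarrow> real" where
  "Ffun N N0 N1 X z = (1 / real N) * (\<Sum>n<N. \<Sum>j<N0. (pos (pre2 N0 N1 z j n) - X j n)\<^sup>2)"

definition Rfun :: "nat \<Rightarrow> nat \<Rightarrow> nat \<Rightarrow> real \<Rightarrow> real \<Rightarrow> (nat \<Rightarrow> real) \<Rightarrow> real" where
  "Rfun N N0 N1 lam1 lam2 z =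
     lam1 * (\<Sum>n<N. \<Sum>i<N1. Vm N0 N1 z i n) + lam2 * (\<Sum>i<N1. \<Sum>j<N0. (Wm N0 N1 z i j)\<^sup>2)"

definition Pfun :: "nat \<Rightarrow> nat \<Rightarrow> nat \<Rightarrow> (nat \<Rightarrow> nat \<Rightarrow> real) \<Rightarrow> real \<Rightarrow> (nat \<Rightarrow> real) \<Rightarrow> real" where
  "Pfun N N0 N1 X beta z = beta * (\<Sum>n<N. \<Sum>i<N1. Vm N0 N1 z i n - pos (pre1 N0 N1 X z i n))"

definition Ofun :: "nat \<Rightarrow> nat \<Rightarrow> nat \<Rightarrow> (nat \<Rightarrow> nat \<Rightarrow> real) \<Rightarrow> real \<Rightarrow> real \<Rightarrow> real \<Rightarrow> (nat \<Rightarrow> real) \<Rightarrow> real" where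
  "Ofun N N0 N1 X lam1 lam2 beta z =
     Ffun N N0 N1 X z + Rfun N N0 N1 lam1 lam2 z + Pfun N N0 N1 X beta z"

definition Omega2 :: "nat \<Rightarrow> nat \<Rightarrow> nat \<Rightarrow> (nat \<Rightarrow> nat \<Rightarrow> real) \<Rightarrow> (nat \<Rightarrow> real) set" where
  "Omega2 N N0 N1 X = {z. \<forall>n<N. \<forall>i<N1. pos (pre1 N0 N1 X z i n) \<le> Vm N0 N1 z i n}"

definition alpha :: "nat \<Rightarrow> nat \<Rightarrow> nat \<Rightarrow> (nat \<Rightarrow> nat \<Rightarrow> real) \<Rightarrow> real \<Rightarrow> real \<Rightarrow> real \<Rightarrow> real" where
  "alpha N N0 N1 X lam1 lam2 theta =
     max (theta / lam1 + sqrt (real N1 * real N0 * theta / lam2) * norm1 N N0 X)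
         (theta * sqrt (real N1 * real N0 * theta) / (lam1 * sqrt lam2) + sqrt (real N * theta) + norm1 N N0 X)"

definition eta :: "nat \<Rightarrow> nat \<Rightarrow> real \<Rightarrow> real \<Rightarrow> real \<Rightarrow> real" where
  "eta N0 N1 lam1 lam2 theta = max (sqrt (real N1 * real N0 * theta / lam2)) (theta / lam1)"

definition Omega3 :: "nat \<Rightarrow> nat \<Rightarrow> real \<Rightarrow> (nat \<Rightarrow> real) set" where
  "Omega3 N0 N1 a = {z. \<forall>i<N1 + N0. \<bar>z (N0 * N1 + i)\<bar> \<le> a}"

definition Zset :: "nat \<Rightarrow> nat \<Rightarrow> nat \<Rightarrow> (nat \<Rightarrow> nat \<Rightarrow> real) \<Rightarrow> real \<Rightarrow> real \<Rightarrow> real \<Rightarrow> (nat \<Rightarrow> real) set" where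
  "Zset N N0 N1 X lam1 lam2 theta =
     Omega2 N N0 N1 X \<inter> Omega3 N0 N1 (alpha N N0 N1 X lam1 lam2 theta) \<inter> supp (dimz N N0 N1)"

definition Omega_theta :: "nat \<Rightarrow> nat \<Rightarrow> nat \<Rightarrow> (nat \<Rightarrow> nat \<Rightarrow> real) \<Rightarrow> real \<Rightarrow> real \<Rightarrow> real \<Rightarrow> real \<Rightarrow> (nat \<Rightarrow> real) set" where
  "Omega_theta N N0 N1 X lam1 lam2 beta theta =
     {z \<in> Omega2 N N0 N1 X. Ofun N N0 N1 X lam1 lam2 beta z \<le> theta}"

definition sig :: "real \<Rightarrow> real \<Rightarrow> real" where
  "sig y mu = (if y < 0 then 0 else if y \<le> mu then y\<^sup>2 / (2 * mu) else y - mu / 2)"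

definition Ftil :: "nat \<Rightarrow> nat \<Rightarrow> nat \<Rightarrow> (nat \<Rightarrow> nat \<Rightarrow> real) \<Rightarrow> (nat \<Rightarrow> real) \<Rightarrow> real \<Rightarrow> real" where
  "Ftil N N0 N1 X z mu =
     (1 / real N) * (\<Sum>n<N. \<Sum>j<N0. (pos (pre2 N0 N1 z j n))\<^sup>2)
     + (1 / real N) * frob2 N N0 X
     - (2 / real N) * (\<Sum>n<N. \<Sum>j<N0. X j n * sig (pre2 N0 N1 z j n) mu)"

definition Ptil :: "nat \<Rightarrow> nat \<Rightarrow> nat \<Rightarrow> (nat \<Rightarrow> nat \<Rightarrow> real) \<Rightarrow> real \<Rightarrow> (nat \<Rightarrow> real) \<Rightarrow> real \<Rightarrow> real" where
  "Ptil N N0 N1 X beta z mu =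
     beta * (\<Sum>n<N. \<Sum>i<N1. Vm N0 N1 z i n - sig (pre1 N0 N1 X z i n) mu)"

definition Htil :: "nat \<Rightarrow> nat \<Rightarrow> nat \<Rightarrow> (nat \<Rightarrow> nat \<Rightarrow> real) \<Rightarrow> real \<Rightarrow> (nat \<Rightarrow> real) \<Rightarrow> real \<Rightarrow> real" where
  "Htil N N0 N1 X beta z mu = Ftil N N0 N1 X z mu + Ptil N N0 N1 X beta z mu"

definition Otil :: "nat \<Rightarrow> nat \<Rightarrow> nat \<Rightarrow> (nat \<Rightarrow> nat \<Rightarrow> real) \<Rightarrow> real \<Rightarrow> real \<Rightarrow> real \<Rightarrow> (nat \<Rightarrow> real) \<Rightarrow> real \<Rightarrow> real" where
  "Otil N N0 N1 X lam1 lam2 beta z mu = Htil N N0 N1 X beta z mu + Rfun N N0 N1 lam1 lam2 z"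

text \<open>Gradient of Htil in z: the vector of partial derivatives (Htil is C^1 in z for mu > 0).\<close>
definition gradH :: "nat \<Rightarrow> nat \<Rightarrow> nat \<Rightarrow> (nat \<Rightarrow> nat \<Rightarrow> real) \<Rightarrow> real \<Rightarrow> (nat \<Rightarrow> real) \<Rightarrow> real \<Rightarrow> nat \<Rightarrow> real" where
  "gradH N N0 N1 X beta z mu =
     (\<lambda>i. if i < dimz N N0 N1 then deriv (\<lambda>t. Htil N N0 N1 X beta (z(i := t)) mu) (z i) else 0)"

definition innerz :: "nat \<Rightarrow> (nat \<Rightarrow> real) \<Rightarrow> (nat \<Rightarrow> real) \<Rightarrow> real" where
  "innerz M u w = (\<Sum>i<M. u i * w i)"

definition sqnorm :: "nat \<Rightarrow> (nat \<Rightarrow> real) \<Rightarrow> real" where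
  "sqnorm M u = (\<Sum>i<M. (u i)\<^sup>2)"

definition distzm :: "nat \<Rightarrow> (nat \<Rightarrow> real) \<Rightarrow> real \<Rightarrow> (nat \<Rightarrow> real) \<Rightarrow> real \<Rightarrow> real" where
  "distzm M z mu z' mu' = sqrt (sqnorm M (\<lambda>i. z i - z' i) + (mu - mu')\<^sup>2)"

definition subobj :: "nat \<Rightarrow> nat \<Rightarrow> nat \<Rightarrow> (nat \<Rightarrow> nat \<Rightarrow> real) \<Rightarrow> real \<Rightarrow> real \<Rightarrow> real
     \<Rightarrow> (nat \<Rightarrow> real) \<Rightarrow> real \<Rightarrow> real \<Rightarrow> (nat \<Rightarrow> real) \<Rightarrow> real" where
  "subobj N N0 N1 X lam1 lam2 beta zk muk Lk z =
     innerz (dimz N N0 N1) (gradH N N0 N1 X beta zk muk) (\<lambda>i. z i - zk i)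
     + Rfun N N0 N1 lam1 lam2 z + Lk / 2 * sqnorm (dimz N N0 N1) (\<lambda>i. z i - zk i)"

end

theory Submission
  imports Defs
begin

text \<open>
  The heart of the matter is that the iterates stay bounded. Since the ReLU is positively homogeneous,
  the feasible set is invariant under shrinking \<open>W\<close>, \<open>b1\<close>, \<open>V\<close> by a factor \<open>1 - s\<close> and \<open>b2\<close> by \<open>1 - 2 * s\<close>.
  Comparing the new iterate with its shrunken copy gives an inequality for the
  weighted norm \<open>Q = |W|\<^sup>2 + |b1|\<^sup>2 + 2 * |b2|\<^sup>2 + |V|\<^sup>2\<close>: the penalty contributes with the right sign, the
  fidelity term is coercive up to a multiple of \<open>theta\<close>, and the discretization error is absorbed once
  \<open>L\<close> is comparable to \<open>(|W|\<^sup>2 + |V|\<^sup>2) / N\<close>. Hence \<open>Q\<close> stays below a bound expressed by \<open>alpha\<close> and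
  \<open>eta\<close>. That the initial \<open>L\<close> is large enough for this is read off from \<open>8 * lam2 + LG\<close>, by testing the
  Lipschitz condition near the corner of the box where all entries of \<open>W\<close> and \<open>V\<close> are maximal.

  On bounded sets a step has length \<open>O(1 / L) = O(mu)\<close>, so the smoothed objective increases by at most
  \<open>O(mu)\<close>, and only at steps where \<open>mu\<close> shrinks geometrically. Adding a multiple of \<open>mu\<close> makes it
  monotone. No descent property of the individual steps is needed, and the objective may exceed
  \<open>theta\<close> along the way.
\<close>

section \<open>The smoothed ReLU\<close>

text \<open>The derivative of \<open>sig\<close> in its first argument, written with
  \<open>pos\<close> so that the three branches of \<open>sig\<close> need no separate
  treatment.\<close>

definition dsig :: "real \<Rightarrow> real \<Rightarrow> real" where
  "dsig y mu = (pos y - pos (y - mu)) / mu"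

text \<open>The derivative of the squared ReLU has a kink at 0. A quadratic bound on the remainder
  gives differentiability at every point in the same way, without gluing one-sided
  derivatives.\<close>

lemma DERIV_of_quadratic_remainder:
  fixes f :: "real \<Rightarrow> real"
  assumes "\<And>t. \<bar>f t - f y - D * (t - y)\<bar> \<le> C * (t - y)\<^sup>2"
  shows "(f has_real_derivative D) (at y)"
proof -
  have "((\<lambda>t. (f t - f y) / (t - y) - D) \<longlongrightarrow> 0) (at y)"
  proof (rule Lim_null_comparison)
    show "\<forall>\<^sub>F t in at y. norm ((f t - f y) / (t - y) - D) \<le> \<bar>C\<bar> * \<bar>t - y\<bar>"
    proof (rule eventually_at_filter[THEN iffD2], rule always_eventually, intro allI impI)
      fix t assume ty: "t \<noteq> y" "t \<in> UNIV"
      have e: "(f t - f y) / (t - y) - D = (f t - f y - D * (t - y)) / (t - y)"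
        using ty by (simp add: divide_simps)
      have "C * (t - y)\<^sup>2 \<le> \<bar>C\<bar> * \<bar>t - y\<bar> * \<bar>t - y\<bar>"
        by (simp add: power2_eq_square mult.assoc mult_right_mono)
      then have "\<bar>f t - f y - D * (t - y)\<bar> \<le> \<bar>C\<bar> * \<bar>t - y\<bar> * \<bar>t - y\<bar>"
        using assms[of t] by linarith
      then show "norm ((f t - f y) / (t - y) - D) \<le> \<bar>C\<bar> * \<bar>t - y\<bar>"
        unfolding e using ty by (simp add: abs_divide divide_simps)
    qed
    show "((\<lambda>t. \<bar>C\<bar> * \<bar>t - y\<bar>) \<longlongrightarrow> 0) (at y)"
      by (auto intro!: tendsto_eq_intros)
  qed
  then show ?thesis
    unfolding has_field_derivative_iff by (simp add: Lim_null[of _ D])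
qed

lemma pos_ge_0: "0 \<le> pos y" and pos_ge: "y \<le> pos y"
  by (auto simp: pos_def)

lemma pos_diff_le: "\<bar>pos a - pos b\<bar> \<le> \<bar>a - b\<bar>"
  by (auto simp: pos_def)

lemma DERIV_pos_sq: "((\<lambda>t. (pos t)\<^sup>2) has_real_derivative 2 * pos y) (at y)"
proof (rule DERIV_of_quadratic_remainder[where C = 1])
  fix t :: real
  show "\<bar>(pos t)\<^sup>2 - (pos y)\<^sup>2 - 2 * pos y * (t - y)\<bar> \<le> 1 * (t - y)\<^sup>2"
  proof (cases "t \<le> 0"; cases "y \<le> 0")
    assume h: "t \<le> 0" "\<not> y \<le> 0"
    have "0 \<le> t * (t - 2 * y)" using h by (intro mult_nonpos_nonpos) auto
    moreover have "0 \<le> y * y" "t * y \<le> 0" using h by (auto intro: mult_nonpos_nonneg)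
    ultimately show ?thesis using h
      by (auto simp: pos_def abs_le_iff power2_eq_square algebra_simps)
  next
    assume h: "\<not> t \<le> 0" "y \<le> 0"
    have "t * (y * 2) \<le> 0" using h by (auto intro: mult_nonneg_nonpos)
    then have "t * (y * 2) \<le> y * y" using zero_le_square[of y] by linarith
    then show ?thesis using h
      by (auto simp: pos_def abs_le_iff power2_eq_square algebra_simps)
  next
    assume h: "\<not> t \<le> 0" "\<not> y \<le> 0"
    have "(pos t)\<^sup>2 - (pos y)\<^sup>2 - 2 * pos y * (t - y) = (t - y)\<^sup>2"
      using h by (auto simp: pos_def power2_eq_square algebra_simps)
    then show ?thesis by simp
  qed (auto simp: pos_def)
qed

text \<open>For \<open>y > mu\<close> the two squares differ by \<open>2 * mu * y - mu * mu\<close>,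
  which yields the affine branch. Differentiability of \<open>sig\<close> thus reduces to that of
  the squared ReLU.\<close>

lemma sig_eq:
  assumes "0 < mu" shows "sig y mu = ((pos y)\<^sup>2 - (pos (y - mu))\<^sup>2) / (2 * mu)"
  using assms by (auto simp: sig_def pos_def max_def field_simps power2_eq_square)

lemma DERIV_sig:
  assumes "0 < mu" shows "((\<lambda>t. sig t mu) has_real_derivative dsig y mu) (at y)"
proof -
  have "((\<lambda>t. t - mu) has_real_derivative 1) (at y)"
    by (auto intro!: derivative_eq_intros)
  from DERIV_chain2[OF DERIV_pos_sq this]
  have "((\<lambda>t. (pos (t - mu))\<^sup>2) has_real_derivative 2 * pos (y - mu)) (at y)"
    by simp
  from DERIV_cdivide[OF DERIV_diff[OF DERIV_pos_sq this], of "2 * mu"]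
  have "((\<lambda>t. ((pos t)\<^sup>2 - (pos (t - mu))\<^sup>2) / (2 * mu)) has_real_derivative
      (2 * pos y - 2 * pos (y - mu)) / (2 * mu)) (at y)" .
  moreover have "(2 * pos y - 2 * pos (y - mu)) / (2 * mu) = dsig y mu"
    using assms by (simp add: dsig_def field_simps)
  ultimately have "((\<lambda>t. ((pos t)\<^sup>2 - (pos (t - mu))\<^sup>2) / (2 * mu)) has_real_derivative dsig y mu) (at y)"
    by simp
  then show ?thesis using sig_eq[OF assms] by simp
qed

lemma dsig_bounds:
  assumes "0 < mu" shows "0 \<le> dsig y mu" "dsig y mu \<le> 1"
  using assms by (auto simp: dsig_def pos_def divide_simps)

lemma dsig_nonpos: "0 < mu \<Longrightarrow> y \<le> 0 \<Longrightarrow> dsig y mu = 0"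
  by (simp add: dsig_def pos_def)

lemma dsig_linear: "0 \<le> y \<Longrightarrow> y \<le> mu \<Longrightarrow> dsig y mu = y / mu"
  by (simp add: dsig_def pos_def)

lemma dsig_saturated: "0 < mu \<Longrightarrow> mu \<le> y \<Longrightarrow> dsig y mu = 1"
  by (simp add: dsig_def pos_def)

lemma sig_bounds:
  assumes "0 < mu" shows "sig y mu \<le> pos y" "pos y - mu / 2 \<le> sig y mu"
proof -
  have "y * y \<le> y * (mu * 2)" if "0 \<le> y" "y \<le> mu" using that assms by (intro mult_left_mono) auto
  then show "sig y mu \<le> pos y"
    using assms by (auto simp: sig_def pos_def power2_eq_square divide_simps mult.commute)
  have "0 \<le> (y - mu)\<^sup>2" by simp
  then have "2 * (y * mu) \<le> y * y + mu * mu" by (simp add: power2_eq_square algebra_simps)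
  then show "pos y - mu / 2 \<le> sig y mu"
    using assms by (auto simp: sig_def pos_def power2_eq_square field_simps)
qed

lemma sig_diff_le:
  assumes mu: "0 < mu" shows "\<bar>sig a mu - sig b mu\<bar> \<le> \<bar>a - b\<bar>"
proof -
  have "norm (sig a mu - sig b mu) \<le> 1 * norm (a - b)"
    by (rule field_differentiable_bound[where S = UNIV and f' = "\<lambda>y. dsig y mu"])
      (use DERIV_sig[OF mu] dsig_bounds[OF mu] in auto)
  then show ?thesis by simp
qed

section \<open>Block structure and the gradient\<close>

lemma sum_lessThan_add:
  fixes f :: "nat \<Rightarrow> real" shows "(\<Sum>i<a + b. f i) = (\<Sum>i<a. f i) + (\<Sum>i<b. f (a + i))"
  by (induction b) (auto simp: algebra_simps)

lemma sum_lessThan_mult: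
  fixes f :: "nat \<Rightarrow> real" shows "(\<Sum>i<a * b. f i) = (\<Sum>j<a. \<Sum>i<b. f (j * b + i))"
proof (induction a)
  case (Suc a)
  have "(\<Sum>i<Suc a * b. f i) = (\<Sum>i<a * b + b. f i)" by (simp add: add.commute)
  then show ?case using Suc by (simp add: sum_lessThan_add)
qed simp

lemma sum_coord_blocks:
  fixes f :: "nat \<Rightarrow> real"
  shows "(\<Sum>i<dimz N N0 N1. f i) =
    (\<Sum>i<N1. \<Sum>j<N0. f (j * N1 + i)) + (\<Sum>i<N1. f (N0 * N1 + i))
    + (\<Sum>j<N0. f (N0 * N1 + N1 + j)) + (\<Sum>n<N. \<Sum>i<N1. f (N0 * N1 + N1 + N0 + n * N1 + i))"
proof -
  have d: "dimz N N0 N1 = N0 * N1 + N1 + N0 + N * N1" by (simp add: dimz_def)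
  show ?thesis
    unfolding d sum_lessThan_add sum_lessThan_mult
    by (simp add: add.assoc sum.swap[of _ "{..<N0}" "{..<N1}"])
qed

definition unitv :: "nat \<Rightarrow> nat \<Rightarrow> real" where
  "unitv i = (\<lambda>k. if k = i then 1 else 0)"

locale autoencoder =
  fixes N N0 N1 :: nat and X :: "nat \<Rightarrow> nat \<Rightarrow> real" and beta :: real
  assumes dims: "0 < N" "0 < N0" "0 < N1" and beta: "0 < beta"
begin

abbreviation "W \<equiv> Wm N0 N1"
abbreviation "b1 \<equiv> b1v N0 N1"
abbreviation "b2 \<equiv> b2v N0 N1"
abbreviation "V \<equiv> Vm N0 N1"
abbreviation "out \<equiv> pre2 N0 N1"
abbreviation "hid \<equiv> pre1 N0 N1 X"
abbreviation "M \<equiv> dimz N N0 N1"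
abbreviation "H \<equiv> Htil N N0 N1 X beta"
abbreviation "gH \<equiv> gradH N N0 N1 X beta"

lemmas blocks = Wm_def b1v_def b2v_def Vm_def

text \<open>The differential of \<open>out\<close> at \<open>z\<close> in direction \<open>e\<close>; \<open>hid\<close> is linear and is its own differential.\<close>
definition dout :: "(nat \<Rightarrow> real) \<Rightarrow> (nat \<Rightarrow> real) \<Rightarrow> nat \<Rightarrow> nat \<Rightarrow> real" where
  "dout z e j n = (\<Sum>i<N1. W e i j * V z i n + W z i j * V e i n) + b2 e j"

text \<open>Half the derivative of a fidelity summand
  \<open>(pos y)\<^sup>2 - 2 * x * sig y mu\<close> with respect to the preactivation
  \<open>y\<close>.\<close>

definition resid :: "(nat \<Rightarrow> real) \<Rightarrow> real \<Rightarrow> nat \<Rightarrow> nat \<Rightarrow> real" where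
  "resid z mu j n = pos (out z j n) - X j n * dsig (out z j n) mu"

text \<open>The differential of \<open>H\<close> in closed form. \<open>gradH\<close> is given by
  partial derivatives through \<open>deriv\<close>; the estimates work with this linear functional
  instead, and \<open>innerz_gradH\<close> identifies the two.\<close>

definition dH :: "(nat \<Rightarrow> real) \<Rightarrow> real \<Rightarrow> (nat \<Rightarrow> real) \<Rightarrow> real" where
  "dH z mu e = (2 / real N) * (\<Sum>n<N. \<Sum>j<N0. resid z mu j n * dout z e j n)
     + beta * (\<Sum>n<N. \<Sum>i<N1. V e i n - dsig (hid z i n) mu * hid e i n)"

lemma hid_add_scale: "hid (\<lambda>k. a k + c * e k) i n = hid a i n + c * hid e i n"
  by (simp add: pre1_def blocks algebra_simps sum.distrib sum_distrib_left)

text \<open>\<open>out\<close> is bilinear in W and V and linear in b2, so the expansion is exact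
  and stops at the quadratic term.\<close>

lemma out_add_scale:
  "out (\<lambda>k. a k + c * e k) j n = out a j n + c * dout a e j n + c\<^sup>2 * (\<Sum>i<N1. W e i j * V e i n)"
  by (simp add: pre2_def dout_def blocks algebra_simps sum.distrib sum_distrib_left power2_eq_square)

lemma dout_add_scale: "dout z (\<lambda>k. a k + c * e k) j n = dout z a j n + c * dout z e j n"
  by (simp add: dout_def blocks algebra_simps sum.distrib sum_distrib_left)

lemma dH_add_scale: "dH z mu (\<lambda>k. a k + c * e k) = dH z mu a + c * dH z mu e"
proof -
  have V: "V (\<lambda>k. a k + c * e k) i n = V a i n + c * V e i n" for i n by (simp add: blocks)
  have "(\<Sum>n<N. \<Sum>j<N0. resid z mu j n * dout z (\<lambda>k. a k + c * e k) j n)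
      = (\<Sum>n<N. \<Sum>j<N0. resid z mu j n * dout z a j n) + c * (\<Sum>n<N. \<Sum>j<N0. resid z mu j n * dout z e j n)"
    by (simp add: dout_add_scale algebra_simps sum.distrib sum_distrib_left)
  moreover have "(\<Sum>n<N. \<Sum>i<N1. V (\<lambda>k. a k + c * e k) i n - dsig (hid z i n) mu * hid (\<lambda>k. a k + c * e k) i n)
    = (\<Sum>n<N. \<Sum>i<N1. V a i n - dsig (hid z i n) mu * hid a i n)
     + c * (\<Sum>n<N. \<Sum>i<N1. V e i n - dsig (hid z i n) mu * hid e i n)"
    by (simp add: V hid_add_scale algebra_simps sum.distrib sum_distrib_left sum_subtractf)
  ultimately show ?thesis unfolding dH_def by (simp add: algebra_simps)
qed

lemma dH_zero: "dH z mu (\<lambda>k. 0) = 0"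
  by (simp add: dH_def dout_def pre1_def blocks)

text \<open>Linearity in \<open>e\<close>, applied while the support of the truncated vector grows
  by one coordinate at a time.\<close>

lemma dH_expand:
  assumes "e \<in> supp M" shows "dH z mu e = (\<Sum>i<M. e i * dH z mu (unitv i))"
proof -
  have "dH z mu (\<lambda>k. if k < m then e k else 0) = (\<Sum>i<m. e i * dH z mu (unitv i))" for m
  proof (induction m)
    case (Suc m)
    have "(\<lambda>k. if k < Suc m then e k else 0) = (\<lambda>k. (if k < m then e k else 0) + e m * unitv m k)"
      by (auto simp: unitv_def fun_eq_iff less_Suc_eq)
    then show ?case using Suc by (simp add: dH_add_scale)
  qed (simp add: dH_zero)
  moreover have "(\<lambda>k. if k < M then e k else 0) = e"
    using assms by (auto simp: supp_def fun_eq_iff not_less)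
  ultimately show ?thesis by metis
qed

text \<open>A single coordinate never lies in both W and V, so the quadratic term of
  \<open>out_add_scale\<close> vanishes.\<close>

lemma out_unitv: "out (\<lambda>k. z k + c * unitv i k) j n = out z j n + c * dout z (unitv i) j n" if "j < N0"
proof -
  have "W (unitv i) i' j * V (unitv i) i' n = 0" if "i' < N1" for i'
  proof -
    have "j * N1 + i' < Suc j * N1" using that by simp
    also have "\<dots> \<le> N0 * N1" using \<open>j < N0\<close> by (intro mult_right_mono) auto
    finally show ?thesis by (auto simp: blocks unitv_def)
  qed
  then have "(\<Sum>i'<N1. W (unitv i) i' j * V (unitv i) i' n) = 0" by (intro sum.neutral) auto
  then show ?thesis by (simp add: out_add_scale)
qed

text \<open>Along one coordinate every preactivation is affine, so the chain rule applies to each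
  summand of \<open>H\<close>.\<close>

lemma DERIV_H_coord:
  assumes mu: "0 < mu"
  shows "((\<lambda>t. H (z(i := t)) mu) has_real_derivative dH z mu (unitv i)) (at (z i))"
proof -
  let ?e = "unitv i"
  have upd: "z(i := t) = (\<lambda>k. z k + (t - z i) * ?e k)" for t
    by (auto simp: unitv_def fun_eq_iff)
  define p where "p j n t = out z j n + (t - z i) * dout z ?e j n" for j n t
  define q where "q i' n t = hid z i' n + (t - z i) * hid ?e i' n" for i' n t
  define v where "v i' n t = V z i' n + (t - z i) * V ?e i' n" for i' n t
  have p: "(p j n has_real_derivative dout z ?e j n) (at (z i))" for j n
    unfolding p_def by (auto intro!: derivative_eq_intros)
  have q: "(q i' n has_real_derivative hid ?e i' n) (at (z i))" for i' n
    unfolding q_def by (auto intro!: derivative_eq_intros)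
  have v: "(v i' n has_real_derivative V ?e i' n) (at (z i))" for i' n
    unfolding v_def by (auto intro!: derivative_eq_intros)
  have p0: "p j n (z i) = out z j n" and q0: "q i' n (z i) = hid z i' n" for j n i'
    by (auto simp: p_def q_def)
  have H: "H (z(i := t)) mu =
      (1 / real N) * (\<Sum>n<N. \<Sum>j<N0. (pos (p j n t))\<^sup>2) + (1 / real N) * frob2 N N0 X
      - (2 / real N) * (\<Sum>n<N. \<Sum>j<N0. X j n * sig (p j n t) mu)
      + beta * (\<Sum>n<N. \<Sum>i'<N1. v i' n t - sig (q i' n t) mu)" for t
  proof -
    have "V (\<lambda>k. z k + (t - z i) * ?e k) i' n = v i' n t" for i' n
      by (simp add: v_def blocks)
    then show ?thesis
      unfolding upd Htil_def Ftil_def Ptil_def by (simp add: out_unitv hid_add_scale p_def q_def)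
  qed
  have pp: "((\<lambda>t. (pos (p j n t))\<^sup>2) has_real_derivative 2 * pos (out z j n) * dout z ?e j n) (at (z i))" for j n
    using DERIV_chain2[OF DERIV_pos_sq p, of j n] by (simp add: p0)
  have sp: "((\<lambda>t. sig (p j n t) mu) has_real_derivative dsig (out z j n) mu * dout z ?e j n) (at (z i))" for j n
    using DERIV_chain2[OF DERIV_sig[OF mu] p, of j n] by (simp add: p0)
  have sq: "((\<lambda>t. sig (q i' n t) mu) has_real_derivative dsig (hid z i' n) mu * hid ?e i' n) (at (z i))" for i' n
    using DERIV_chain2[OF DERIV_sig[OF mu] q, of i' n] by (simp add: q0)
  show ?thesis
    unfolding H
    by (rule derivative_eq_intros pp sp sq v refl)+
      (simp add: dH_def resid_def algebra_simps sum.distrib sum_distrib_left sum_subtractf)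
qed

lemma innerz_gradH:
  assumes "0 < mu" "e \<in> supp M" shows "innerz M (gH z mu) e = dH z mu e"
proof -
  have "gH z mu i = dH z mu (unitv i)" if "i < M" for i
    using that DERIV_imp_deriv[OF DERIV_H_coord[OF assms(1)]] by (simp add: gradH_def)
  then show ?thesis using dH_expand[OF assms(2)] by (simp add: innerz_def mult.commute)
qed

end

section \<open>Dissipation of a weighted norm\<close>

text \<open>A first-order condition without derivatives: divide by \<open>s\<close> and let
  \<open>s\<close> tend to 0. The range stops at \<open>1 / 2\<close> because the output bias is
  shrunk by \<open>1 - 2 * s\<close>.\<close>

lemma nonpos_of_quadratic_nonneg:
  fixes a b :: real
  assumes "\<And>s. 0 < s \<Longrightarrow> s \<le> 1 / 2 \<Longrightarrow> s * a \<le> s\<^sup>2 * b" shows "a \<le> 0"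
proof (rule field_le_epsilon)
  fix e :: real assume e: "0 < e"
  define s where "s = min (1 / 2) (e / (\<bar>b\<bar> + 1))"
  have s: "0 < s" "s \<le> 1 / 2" "s \<le> e / (\<bar>b\<bar> + 1)"
    using e min.cobounded1[of "1 / 2" "e / (\<bar>b\<bar> + 1)"] by (simp_all add: s_def)
  have "s * a \<le> s * (s * b)" using assms[OF s(1,2)] by (simp add: power2_eq_square mult.assoc)
  then have "a \<le> s * b" using s(1) by simp
  also have "s * b \<le> s * (\<bar>b\<bar> + 1)" using s by (intro mult_left_mono) auto
  also have "\<dots> \<le> e" using s(3) by (simp add: field_simps)
  finally show "a \<le> 0 + e" by simp
qed

text \<open>Submultiplicativity of the Frobenius norm, by Cauchy-Schwarz in each entry of the
  product.\<close>

lemma sum_sq_mult_le: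
  fixes f :: "nat \<Rightarrow> nat \<Rightarrow> real" and g :: "nat \<Rightarrow> nat \<Rightarrow> real"
  shows "(\<Sum>i<a. \<Sum>j<b. (\<Sum>n<c. f j n * g i n)\<^sup>2) \<le> (\<Sum>n<c. \<Sum>j<b. (f j n)\<^sup>2) * (\<Sum>n<c. \<Sum>i<a. (g i n)\<^sup>2)"
proof -
  have "(\<Sum>i<a. \<Sum>j<b. (\<Sum>n<c. f j n * g i n)\<^sup>2)
      \<le> (\<Sum>i<a. \<Sum>j<b. (\<Sum>n<c. (f j n)\<^sup>2) * (\<Sum>n<c. (g i n)\<^sup>2))"
    by (intro sum_mono Cauchy_Schwarz_ineq_sum)
  also have "\<dots> = (\<Sum>j<b. \<Sum>n<c. (f j n)\<^sup>2) * (\<Sum>i<a. \<Sum>n<c. (g i n)\<^sup>2)"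
    by (simp add: sum_distrib_left[symmetric] sum_distrib_right[symmetric])
  also have "\<dots> = (\<Sum>n<c. \<Sum>j<b. (f j n)\<^sup>2) * (\<Sum>n<c. \<Sum>i<a. (g i n)\<^sup>2)"
    by (subst sum.swap, subst (2) sum.swap) simp
  finally show ?thesis .
qed

locale spg_problem = autoencoder +
  fixes lam1 lam2 theta :: real
  assumes lam: "0 < lam1" "0 < lam2" and theta: "theta > frob2 N N0 X / real N"
begin

abbreviation "R \<equiv> Rfun N N0 N1 lam1 lam2"
abbreviation "Z \<equiv> Zset N N0 N1 X lam1 lam2 theta"
abbreviation "alph \<equiv> alpha N N0 N1 X lam1 lam2 theta"
abbreviation "et \<equiv> eta N0 N1 lam1 lam2 theta"

definition normW :: "(nat \<Rightarrow> real) \<Rightarrow> real" where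
  "normW z = (\<Sum>i<N1. \<Sum>j<N0. (W z i j)\<^sup>2)"

definition normV :: "(nat \<Rightarrow> real) \<Rightarrow> real" where
  "normV z = (\<Sum>n<N. \<Sum>i<N1. (V z i n)\<^sup>2)"

definition sumV :: "(nat \<Rightarrow> real) \<Rightarrow> real" where
  "sumV z = (\<Sum>n<N. \<Sum>i<N1. V z i n)"

text \<open>
  The output bias gets weight 2 because then the differential of \<open>out\<close> at \<open>z\<close>, applied to the
  weighted \<open>z\<close>, is exactly \<open>2 * out z\<close>.
\<close>
definition wt :: "nat \<Rightarrow> real" where
  "wt k = (if N0 * N1 + N1 \<le> k \<and> k < N0 * N1 + N1 + N0 then 2 else 1)"

definition Q :: "(nat \<Rightarrow> real) \<Rightarrow> real" where
  "Q z = (\<Sum>k<M. wt k * (z k)\<^sup>2)"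

lemma theta_pos: "0 < theta"
proof -
  have "0 \<le> frob2 N N0 X / real N" by (simp add: frob2_def sum_nonneg)
  then show ?thesis using theta by linarith
qed

lemma index_less: "i < N1 \<Longrightarrow> j < N0 \<Longrightarrow> j * N1 + i < N0 * N1"
proof -
  assume "i < N1" "j < N0"
  then have "j * N1 + i < Suc j * N1" by simp
  also have "\<dots> \<le> N0 * N1" using \<open>j < N0\<close> by (intro mult_right_mono) auto
  finally show ?thesis .
qed

lemma wt_blocks:
  "i < N1 \<Longrightarrow> j < N0 \<Longrightarrow> wt (j * N1 + i) = 1"
  "i < N1 \<Longrightarrow> wt (N0 * N1 + i) = 1"
  "j < N0 \<Longrightarrow> wt (N0 * N1 + N1 + j) = 2"
  "wt (N0 * N1 + N1 + N0 + n * N1 + i) = 1"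
  using index_less[of i j] by (auto simp: wt_def)

lemma Q_blocks:
  "Q z = normW z + (\<Sum>i<N1. (b1 z i)\<^sup>2) + 2 * (\<Sum>j<N0. (b2 z j)\<^sup>2) + normV z"
proof -
  have "(\<Sum>i<N1. \<Sum>j<N0. wt (j * N1 + i) * (z (j * N1 + i))\<^sup>2) = normW z"
    unfolding normW_def blocks by (intro sum.cong refl) (simp add: wt_blocks)
  moreover have "(\<Sum>j<N0. wt (N0 * N1 + N1 + j) * (z (N0 * N1 + N1 + j))\<^sup>2) = 2 * (\<Sum>j<N0. (b2 z j)\<^sup>2)"
    unfolding sum_distrib_left blocks by (intro sum.cong refl) (simp add: wt_blocks)
  moreover have "(\<Sum>i<N1. wt (N0 * N1 + i) * (z (N0 * N1 + i))\<^sup>2) = (\<Sum>i<N1. (b1 z i)\<^sup>2)"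
    unfolding blocks by (intro sum.cong refl) (simp add: wt_blocks)
  moreover have "(\<Sum>n<N. \<Sum>i<N1. wt (N0 * N1 + N1 + N0 + n * N1 + i) * (z (N0 * N1 + N1 + N0 + n * N1 + i))\<^sup>2)
      = normV z"
    unfolding normV_def blocks by (intro sum.cong refl) (simp add: wt_blocks)
  ultimately show ?thesis unfolding Q_def sum_coord_blocks by simp
qed

lemma Z_memD:
  assumes "z \<in> Z"
  shows "z \<in> Omega2 N N0 N1 X" "z \<in> Omega3 N0 N1 alph" "z \<in> supp M"
  using assms by (auto simp: Zset_def)

lemma V_nonneg: "z \<in> Z \<Longrightarrow> n < N \<Longrightarrow> i < N1 \<Longrightarrow> pos (hid z i n) \<le> V z i n \<and> 0 \<le> V z i n"
  using pos_ge_0[of "hid z i n"] unfolding Zset_def Omega2_def by force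

lemma scaled_blocks:
  "i < N1 \<Longrightarrow> j < N0 \<Longrightarrow> W (\<lambda>k. (1 - s * wt k) * z k) i j = (1 - s) * W z i j"
  "i < N1 \<Longrightarrow> b1 (\<lambda>k. (1 - s * wt k) * z k) i = (1 - s) * b1 z i"
  "V (\<lambda>k. (1 - s * wt k) * z k) i n = (1 - s) * V z i n"
  by (auto simp: blocks wt_blocks)

lemma weighted_blocks:
  "i < N1 \<Longrightarrow> j < N0 \<Longrightarrow> W (\<lambda>k. wt k * z k) i j = W z i j"
  "i < N1 \<Longrightarrow> b1 (\<lambda>k. wt k * z k) i = b1 z i"
  "j < N0 \<Longrightarrow> b2 (\<lambda>k. wt k * z k) j = 2 * b2 z j"
  "V (\<lambda>k. wt k * z k) i n = V z i n"
  by (auto simp: blocks wt_blocks)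

text \<open>\<open>hid\<close> is homogeneous in W and b1. For \<open>s <= 1 / 2\<close> both
  factors \<open>1 - s\<close> and \<open>1 - 2 * s\<close> lie in \<open>[0, 1]\<close>, so the
  ReLU commutes with the scaling and the biases stay in their box.\<close>

lemma scaled_in_Z:
  assumes z: "z \<in> Z" and s: "0 < s" "s \<le> 1 / 2"
  shows "(\<lambda>k. (1 - s * wt k) * z k) \<in> Z" (is "?w \<in> Z")
proof -
  have "hid ?w i n = (1 - s) * hid z i n" if "i < N1" for i n
  proof -
    have "hid ?w i n = (\<Sum>j<N0. (1 - s) * (W z i j * X j n)) + (1 - s) * b1 z i"
      unfolding pre1_def using that by (simp add: scaled_blocks mult.assoc)
    then show ?thesis by (simp add: pre1_def sum_distrib_left distrib_left)
  qed
  then have "pos (hid ?w i n) = (1 - s) * pos (hid z i n)" if "i < N1" for i n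
    using that s by (simp add: pos_def max_def mult_le_0_iff)
  then have "?w \<in> Omega2 N N0 N1 X"
    using V_nonneg[OF z] s by (auto simp: Omega2_def scaled_blocks(3) intro!: mult_left_mono)
  moreover have "\<bar>?w k\<bar> \<le> \<bar>z k\<bar>" for k
    using s by (auto simp: wt_def abs_mult intro!: mult_left_le_one_le)
  then have "?w \<in> Omega3 N0 N1 alph"
    using Z_memD(2)[OF z] unfolding Omega3_def by (blast intro: order_trans)
  moreover have "?w \<in> supp M" using Z_memD(3)[OF z] by (auto simp: supp_def)
  ultimately show ?thesis by (auto simp: Zset_def)
qed

text \<open>The first-order condition along the shrinking. The factor of \<open>L / 2\<close> is, by
  polarization, twice the inner product of \<open>wt * z'\<close> and \<open>z' - z\<close>; its
  summand \<open>Q (z' - z)\<close> is the reserve that \<open>dissipation\<close> spends.\<close>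

lemma optimality_along_scaling:
  assumes mu: "0 < mu" and z: "z \<in> Z" and z': "z' \<in> Z"
    and opt: "\<And>w. w \<in> Z \<Longrightarrow>
      subobj N N0 N1 X lam1 lam2 beta z mu L z' \<le> subobj N N0 N1 X lam1 lam2 beta z mu L w"
  shows "dH z mu (\<lambda>k. wt k * z' k) + lam1 * sumV z' + 2 * lam2 * normW z'
    + L / 2 * (Q z' - Q z + Q (\<lambda>k. z' k - z k)) \<le> 0"
proof (rule nonpos_of_quadratic_nonneg)
  fix s :: real assume s: "0 < s" "s \<le> 1 / 2"
  let ?w = "\<lambda>k. (1 - s * wt k) * z' k" and ?d = "\<lambda>k. z' k - z k"
  let ?D = "\<lambda>k. wt k * z' k"
  have "?D \<in> supp M" using Z_memD(3)[OF z'] by (auto simp: supp_def)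
  then have g: "dH z mu ?D = innerz M (gH z mu) ?D" using innerz_gradH[OF mu] by metis
  have i: "innerz M (gH z mu) (\<lambda>k. ?w k - z k) = innerz M (gH z mu) ?d - s * innerz M (gH z mu) ?D"
    by (simp add: innerz_def algebra_simps sum.distrib sum_distrib_left sum_subtractf)
  have sV: "sumV ?w = (1 - s) * sumV z'" and nW: "normW ?w = (1 - s)\<^sup>2 * normW z'"
    by (simp_all add: sumV_def normW_def scaled_blocks sum_distrib_left power_mult_distrib)
  have Rw: "R w = lam1 * sumV w + lam2 * normW w" for w
    by (simp add: Rfun_def sumV_def normW_def)
  have sq: "sqnorm M (\<lambda>k. ?w k - z k)
      = sqnorm M ?d - s * (Q z' - Q z + Q ?d) + s\<^sup>2 * sqnorm M ?D"
  proof -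
    have "(?w k - z k)\<^sup>2 = (?d k)\<^sup>2 - s * (wt k * (z' k)\<^sup>2 - wt k * (z k)\<^sup>2 + wt k * (?d k)\<^sup>2)
        + s\<^sup>2 * (?D k)\<^sup>2" for k
      by (simp add: power2_eq_square algebra_simps)
    moreover have "(\<Sum>k<M. s * (wt k * (z' k)\<^sup>2 - wt k * (z k)\<^sup>2 + wt k * (?d k)\<^sup>2)) = s * (Q z' - Q z + Q ?d)"
      by (simp add: Q_def sum.distrib sum_subtractf sum_distrib_left[symmetric])
    moreover have "(\<Sum>k<M. s\<^sup>2 * (?D k)\<^sup>2) = s\<^sup>2 * sqnorm M ?D"
      by (simp add: sqnorm_def sum_distrib_left)
    ultimately show ?thesis by (simp only: sqnorm_def sum.distrib sum_subtractf)
  qed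
  have "innerz M (gH z mu) ?d + R z' + L / 2 * sqnorm M ?d
      \<le> innerz M (gH z mu) (\<lambda>k. ?w k - z k) + R ?w + L / 2 * sqnorm M (\<lambda>k. ?w k - z k)"
    using opt[OF scaled_in_Z[OF z' s]] by (simp add: subobj_def)
  then show "s * (dH z mu ?D + lam1 * sumV z' + 2 * lam2 * normW z' + L / 2 * (Q z' - Q z + Q ?d))
      \<le> s\<^sup>2 * (lam2 * normW z' + L / 2 * sqnorm M ?D)"
    unfolding i sq Rw sV nW g by (simp add: power2_eq_square algebra_simps)
qed

text \<open>Homogeneity of the ReLU makes the penalty part of the differential nonnegative.\<close>
lemma dH_weighted_ge:
  assumes mu: "0 < mu" and z': "z' \<in> Z"
  shows "(2 / real N) * (\<Sum>n<N. \<Sum>j<N0. resid z mu j n * dout z (\<lambda>k. wt k * z' k) j n)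
    \<le> dH z mu (\<lambda>k. wt k * z' k)"
proof -
  have "dsig (hid z i n) mu * hid (\<lambda>k. wt k * z' k) i n \<le> V (\<lambda>k. wt k * z' k) i n"
    if "n < N" "i < N1" for i n
  proof -
    have h: "hid (\<lambda>k. wt k * z' k) i n = hid z' i n" and v: "V (\<lambda>k. wt k * z' k) i n = V z' i n"
      using that by (auto simp: pre1_def weighted_blocks)
    have "dsig (hid z i n) mu * hid z' i n \<le> dsig (hid z i n) mu * pos (hid z' i n)"
      using dsig_bounds[OF mu] pos_ge by (intro mult_left_mono)
    also have "\<dots> \<le> pos (hid z' i n)"
      using dsig_bounds[OF mu] pos_ge_0 by (intro mult_left_le_one_le)
    also have "\<dots> \<le> V z' i n" using V_nonneg[OF z' that] by simp
    finally show ?thesis unfolding h v .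
  qed
  then have "0 \<le> beta * (\<Sum>n<N. \<Sum>i<N1. V (\<lambda>k. wt k * z' k) i n
      - dsig (hid z i n) mu * hid (\<lambda>k. wt k * z' k) i n)"
    using beta by (intro mult_nonneg_nonneg sum_nonneg) auto
  then show ?thesis unfolding dH_def by linarith
qed

text \<open>For positive \<open>out = r + s\<close> the claim follows from
  \<open>(4 * r + 6 * s)\<^sup>2 >= 0\<close> and \<open>s\<^sup>2 <= (X j n)\<^sup>2\<close>. It
  makes residual times preactivation coercive in the residual, up to the data.\<close>

lemma resid_out_le:
  assumes "0 < mu"
  shows "16 / 3 * (resid z mu j n)\<^sup>2 - 8 * (resid z mu j n * out z j n) \<le> 6 * (X j n)\<^sup>2"
proof (cases "out z j n \<le> 0")
  case True
  then show ?thesis by (simp add: resid_def dsig_nonpos[OF assms] pos_def)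
next
  case False
  define s where "s = X j n * dsig (out z j n) mu"
  define r where "r = out z j n - s"
  have "r = resid z mu j n" using False by (simp add: r_def resid_def s_def pos_def)
  moreover have "0 \<le> (4 * r + 6 * s)\<^sup>2" by simp
  then have "16 / 3 * r\<^sup>2 - 8 * (r * out z j n) \<le> 6 * s\<^sup>2"
    by (simp add: r_def power2_eq_square algebra_simps)
  moreover have "s\<^sup>2 \<le> (X j n)\<^sup>2"
    using dsig_bounds[OF assms, of "out z j n"]
    by (auto simp: s_def power_mult_distrib power_le_one intro: mult_left_le)
  ultimately show ?thesis by simp
qed

text \<open>The differential is taken at \<open>z\<close> but applied to the weighted
  \<open>z'\<close>. With \<open>z' = z + d\<close>, the part from \<open>z\<close> is coercive by
  \<open>resid_out_le\<close>. The part linear in \<open>d\<close> is absorbed by \<open>Q d\<close>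
  through Young's inequality, at the cost of the squared fidelity gradient over \<open>L\<close>,
  which \<open>large\<close> keeps within the coercive part.\<close>

lemma dissipation:
  assumes mu: "0 < mu" and L: "0 < L" and z: "z \<in> Z" and z': "z' \<in> Z"
    and opt: "\<And>w. w \<in> Z \<Longrightarrow>
      subobj N N0 N1 X lam1 lam2 beta z mu L z' \<le> subobj N N0 N1 X lam1 lam2 beta z mu L w"
    and large: "3 / 4 * (normV z + normW z + 2 * real N) \<le> real N * L"
  shows "Q z' \<le> Q z + 2 / L * (3 * theta - (lam1 * sumV z' + 2 * lam2 * normW z'))"
proof -
  let ?d = "\<lambda>k. z' k - z k"
  define r where "r j n = resid z mu j n" for j n
  define c where "c = 2 / (real N * L)"
  define S where "S = (\<Sum>n<N. \<Sum>j<N0. (r j n)\<^sup>2)"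
  \<comment> \<open>\<open>GW\<close>, \<open>GV\<close> and \<open>Gb\<close> are the blocks of the
    fidelity gradient at \<open>z\<close>, divided by \<open>L\<close>.\<close>
  define GW where "GW i j = c * (\<Sum>n<N. r j n * V z i n)" for i j
  define GV where "GV n i = c * (\<Sum>j<N0. r j n * W z i j)" for i n
  define Gb where "Gb j = c * (\<Sum>n<N. r j n * 1)" for j
  have N: "0 < real N" using dims by simp
  have c: "0 < c" using N L by (simp add: c_def)
  \<comment> \<open>The weights make \<open>wt * z\<close> contribute exactly
    \<open>2 * out z j n\<close>; the other terms come from \<open>z' - z\<close>.\<close>
  have dout: "dout z (\<lambda>k. wt k * z' k) j n
      = 2 * out z j n + (\<Sum>i<N1. W ?d i j * V z i n + W z i j * V ?d i n) + 2 * b2 ?d j"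
    if "j < N0" for j n
  proof -
    have d: "W ?d i j = W z' i j - W z i j" "V ?d i n = V z' i n - V z i n" "b2 ?d j = b2 z' j - b2 z j" for i
      by (simp_all add: blocks)
    have "dout z (\<lambda>k. wt k * z' k) j n
        = (\<Sum>i<N1. W z' i j * V z i n + W z i j * V z' i n) + 2 * b2 z' j"
      using that by (simp add: dout_def weighted_blocks)
    then show ?thesis unfolding d
      by (simp add: pre2_def algebra_simps sum.distrib sum_subtractf sum_distrib_left)
  qed
  have cross: "c * (\<Sum>n<N. \<Sum>j<N0. r j n * dout z (\<lambda>k. wt k * z' k) j n)
      = 2 * c * (\<Sum>n<N. \<Sum>j<N0. r j n * out z j n)
        + (\<Sum>i<N1. \<Sum>j<N0. W ?d i j * GW i j) + (\<Sum>n<N. \<Sum>i<N1. V ?d i n * GV n i)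
        + 2 * (\<Sum>j<N0. b2 ?d j * Gb j)"
  proof -
    have "(\<Sum>i<N1. \<Sum>j<N0. W ?d i j * GW i j)
        = c * (\<Sum>n<N. \<Sum>j<N0. \<Sum>i<N1. r j n * (W ?d i j * V z i n))"
    proof -
      have "(\<Sum>i<N1. \<Sum>j<N0. W ?d i j * GW i j)
          = (\<Sum>i<N1. \<Sum>j<N0. \<Sum>n<N. c * (r j n * (W ?d i j * V z i n)))"
        by (simp add: GW_def sum_distrib_left ac_simps)
      also have "\<dots> = (\<Sum>i<N1. \<Sum>n<N. \<Sum>j<N0. c * (r j n * (W ?d i j * V z i n)))"
        by (intro sum.cong refl sum.swap)
      also have "\<dots> = (\<Sum>n<N. \<Sum>i<N1. \<Sum>j<N0. c * (r j n * (W ?d i j * V z i n)))"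
        by (rule sum.swap)
      also have "\<dots> = (\<Sum>n<N. \<Sum>j<N0. \<Sum>i<N1. c * (r j n * (W ?d i j * V z i n)))"
        by (intro sum.cong refl sum.swap)
      finally show ?thesis by (simp add: sum_distrib_left)
    qed
    moreover have "(\<Sum>n<N. \<Sum>i<N1. V ?d i n * GV n i)
        = c * (\<Sum>n<N. \<Sum>j<N0. \<Sum>i<N1. r j n * (W z i j * V ?d i n))"
    proof -
      have "(\<Sum>n<N. \<Sum>i<N1. V ?d i n * GV n i)
          = (\<Sum>n<N. \<Sum>i<N1. \<Sum>j<N0. c * (r j n * (W z i j * V ?d i n)))"
        by (simp add: GV_def sum_distrib_left ac_simps)
      also have "\<dots> = (\<Sum>n<N. \<Sum>j<N0. \<Sum>i<N1. c * (r j n * (W z i j * V ?d i n)))"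
        by (intro sum.cong refl sum.swap)
      finally show ?thesis by (simp add: sum_distrib_left)
    qed
    moreover have "(\<Sum>j<N0. b2 ?d j * Gb j) = c * (\<Sum>n<N. \<Sum>j<N0. r j n * b2 ?d j)"
      by (subst sum.swap) (simp add: Gb_def sum_distrib_left sum_distrib_right ac_simps)
    moreover have "(\<Sum>n<N. \<Sum>j<N0. r j n * dout z (\<lambda>k. wt k * z' k) j n)
        = 2 * (\<Sum>n<N. \<Sum>j<N0. r j n * out z j n)
        + (\<Sum>n<N. \<Sum>j<N0. \<Sum>i<N1. r j n * (W ?d i j * V z i n))
        + (\<Sum>n<N. \<Sum>j<N0. \<Sum>i<N1. r j n * (W z i j * V ?d i n))
        + 2 * (\<Sum>n<N. \<Sum>j<N0. r j n * b2 ?d j)"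
    proof -
      have "(\<Sum>n<N. \<Sum>j<N0. r j n * dout z (\<lambda>k. wt k * z' k) j n)
          = (\<Sum>n<N. \<Sum>j<N0. 2 * (r j n * out z j n) + (\<Sum>i<N1. r j n * (W ?d i j * V z i n))
             + (\<Sum>i<N1. r j n * (W z i j * V ?d i n)) + 2 * (r j n * b2 ?d j))"
        by (intro sum.cong refl) (simp add: dout distrib_left sum.distrib sum_distrib_left)
      then show ?thesis by (simp add: sum.distrib sum_distrib_left)
    qed
    ultimately show ?thesis by (simp add: algebra_simps)
  qed
  have young: "- (2 * (a * b)) \<le> a\<^sup>2 + b\<^sup>2" for a b :: real
    using zero_le_power2[of "a + b"] by (simp add: power2_eq_square algebra_simps)
  have yW: "- (2 * (\<Sum>i<N1. \<Sum>j<N0. W ?d i j * GW i j)) \<le> normW ?d + (\<Sum>i<N1. \<Sum>j<N0. (GW i j)\<^sup>2)"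
    unfolding normW_def sum.distrib[symmetric] sum_distrib_left sum_negf[symmetric]
    by (intro sum_mono young)
  have yV: "- (2 * (\<Sum>n<N. \<Sum>i<N1. V ?d i n * GV n i)) \<le> normV ?d + (\<Sum>n<N. \<Sum>i<N1. (GV n i)\<^sup>2)"
    unfolding normV_def sum.distrib[symmetric] sum_distrib_left sum_negf[symmetric]
    by (intro sum_mono young)
  have yb: "- (2 * (\<Sum>j<N0. b2 ?d j * Gb j)) \<le> (\<Sum>j<N0. (b2 ?d j)\<^sup>2) + (\<Sum>j<N0. (Gb j)\<^sup>2)"
    unfolding sum.distrib[symmetric] sum_distrib_left sum_negf[symmetric]
    by (intro sum_mono young)
  have GW: "(\<Sum>i<N1. \<Sum>j<N0. (GW i j)\<^sup>2) \<le> c\<^sup>2 * (S * normV z)"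
    unfolding GW_def power_mult_distrib sum_distrib_left[symmetric] S_def normV_def
    by (intro mult_left_mono sum_sq_mult_le) auto
  have GV: "(\<Sum>n<N. \<Sum>i<N1. (GV n i)\<^sup>2) \<le> c\<^sup>2 * (S * normW z)"
  proof -
    have "(\<Sum>n<N. \<Sum>i<N1. (\<Sum>j<N0. r j n * W z i j)\<^sup>2)
        = (\<Sum>i<N1. \<Sum>n<N. (\<Sum>j<N0. r j n * W z i j)\<^sup>2)"
      by (rule sum.swap)
    also have "\<dots> \<le> (\<Sum>j<N0. \<Sum>n<N. (r j n)\<^sup>2) * (\<Sum>j<N0. \<Sum>i<N1. (W z i j)\<^sup>2)"
      using sum_sq_mult_le[where f = "\<lambda>n j. r j n" and g = "\<lambda>i j. W z i j"] by simp
    also have "\<dots> = S * normW z"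
      unfolding S_def normW_def by (subst sum.swap, subst (2) sum.swap) simp
    finally show ?thesis
      unfolding GV_def power_mult_distrib sum_distrib_left[symmetric] by (intro mult_left_mono) auto
  qed
  have Gb: "(\<Sum>j<N0. (Gb j)\<^sup>2) \<le> c\<^sup>2 * (S * real N)"
  proof -
    have "(\<Sum>j<N0. (\<Sum>n<N. r j n * 1)\<^sup>2) \<le> (\<Sum>j<N0. (\<Sum>n<N. (r j n)\<^sup>2) * (\<Sum>n<N. 1\<^sup>2))"
      by (intro sum_mono Cauchy_Schwarz_ineq_sum)
    also have "\<dots> = S * real N"
      unfolding S_def by (subst sum.swap) (simp add: sum_distrib_right)
    finally show ?thesis
      unfolding Gb_def power_mult_distrib sum_distrib_left[symmetric] by (intro mult_left_mono) auto
  qed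
  have S0: "0 \<le> S" by (simp add: S_def sum_nonneg)
  \<comment> \<open>By \<open>large\<close>, \<open>c\<close> times the bracket is at most
    \<open>2 * (4 / 3)\<close>. The summand \<open>2 * real N\<close> stems from the output bias and
    its weight 2.\<close>
  have "c\<^sup>2 * (S * (normV z + normW z + 2 * real N)) \<le> 8 / 3 * c * S"
  proof -
    have "c * (normV z + normW z + 2 * real N) \<le> 8 / 3"
      using large N L by (simp add: c_def field_simps)
    then have "(c * S) * (c * (normV z + normW z + 2 * real N)) \<le> (c * S) * (8 / 3)"
      using c S0 by (intro mult_left_mono) auto
    then show ?thesis by (simp add: power2_eq_square algebra_simps)
  qed
  \<comment> \<open>This is \<open>c / 2\<close> times the sum of \<open>resid_out_le\<close>; the
    coefficient 16/3 there is what makes the terms in \<open>S\<close> cancel.\<close>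
  moreover have "8 / 3 * c * S - 4 * c * (\<Sum>n<N. \<Sum>j<N0. r j n * out z j n) \<le> 3 * c * frob2 N N0 X"
  proof -
    have "16 / 3 * S - 8 * (\<Sum>n<N. \<Sum>j<N0. r j n * out z j n)
        = (\<Sum>n<N. \<Sum>j<N0. 16 / 3 * (r j n)\<^sup>2 - 8 * (r j n * out z j n))"
      by (simp add: S_def sum_subtractf sum_distrib_left)
    also have "\<dots> \<le> (\<Sum>n<N. \<Sum>j<N0. 6 * (X j n)\<^sup>2)"
      unfolding r_def by (intro sum_mono resid_out_le mu)
    also have "\<dots> = 6 * frob2 N N0 X"
      unfolding frob2_def by (subst (2) sum.swap) (simp add: sum_distrib_left)
    finally have "c / 2 * (16 / 3 * S - 8 * (\<Sum>n<N. \<Sum>j<N0. r j n * out z j n)) \<le> c / 2 * (6 * frob2 N N0 X)"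
      using c by (intro mult_left_mono) auto
    then show ?thesis by (simp add: algebra_simps)
  qed
  moreover have "normW ?d + normV ?d + 2 * (\<Sum>j<N0. (b2 ?d j)\<^sup>2) \<le> Q ?d"
    unfolding Q_blocks by (simp add: sum_nonneg)
  moreover have "c\<^sup>2 * (S * (normV z + normW z + 2 * real N))
      = c\<^sup>2 * (S * normV z) + c\<^sup>2 * (S * normW z) + 2 * (c\<^sup>2 * (S * real N))"
    by (simp add: algebra_simps)
  ultimately have key: "- (2 * c * (\<Sum>n<N. \<Sum>j<N0. r j n * dout z (\<lambda>k. wt k * z' k) j n))
      \<le> Q ?d + 3 * c * frob2 N N0 X"
    using cross yW yV yb GW GV Gb by (simp add: algebra_simps)
  have "2 / L * (2 / real N * (\<Sum>n<N. \<Sum>j<N0. r j n * dout z (\<lambda>k. wt k * z' k) j n)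
     + lam1 * sumV z' + 2 * lam2 * normW z' + L / 2 * (Q z' - Q z + Q ?d)) \<le> 2 / L * 0"
    using optimality_along_scaling[OF mu z z' opt] dH_weighted_ge[OF mu z', of z] L
    by (intro mult_left_mono) (auto simp: r_def)
  then have "2 * c * (\<Sum>n<N. \<Sum>j<N0. r j n * dout z (\<lambda>k. wt k * z' k) j n)
     + 2 / L * (lam1 * sumV z' + 2 * lam2 * normW z') + (Q z' - Q z + Q ?d) \<le> 0"
    using L by (simp add: c_def field_simps)
  moreover have "3 * c * frob2 N N0 X \<le> 2 / L * (3 * theta)"
    using theta N L by (simp add: c_def field_simps)
  ultimately show ?thesis using key by (simp add: right_diff_distrib)
qed

end

section \<open>A lower bound for the Lipschitz constant\<close>

text \<open>The gradient hypothesis covers only smoothing parameters below 1. The inequality wanted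
  at \<open>mu = 1\<close> is the limit of those at \<open>mu = 1 - e\<close>.\<close>

lemma le_of_eventually_le:
  fixes f :: "real \<Rightarrow> real"
  assumes "isCont f 0" "0 < tt" "\<And>t. 0 < t \<Longrightarrow> t < tt \<Longrightarrow> f t \<le> c"
  shows "f 0 \<le> c"
proof (rule tendsto_upperbound)
  show "(f \<longlongrightarrow> f 0) (at_right 0)"
    using assms(1) by (simp add: isCont_def filterlim_at_split)
  show "\<forall>\<^sub>F t in at_right 0. f t \<le> c"
    unfolding eventually_at_right_field using assms(2,3) by auto
qed simp

text \<open>Compares, after squaring, the step size required by the dissipation estimate with the
  Lipschitz bound of the saturated regime.\<close>
lemma saturated_constant:
  fixes n n0 n1 q :: real
  assumes n: "1 \<le> n" "1 \<le> n0" "1 \<le> n1" and q: "0 \<le> q"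
  shows "(3 / 8 * ((9 / 4 + n1 + 2 * n0) * q + 2))\<^sup>2
    \<le> (1 + n1 * n0 * q)\<^sup>2 + n1 * n * q * (1 + 3 * (n1 * n0 * q))"
proof -
  have p: "n0 \<le> n1 * n0" "n1 \<le> n1 * n0" "n1 \<le> n1 * n" "1 \<le> n1 * n0"
    using n mult_mono[of 1 n1 n0 n0] mult_mono[of n1 n1 1 n0] mult_mono[of n1 n1 1 n]
      mult_mono[of 1 n1 1 n0] by auto
  have lin: "9 / 16 * (9 / 4 + n1 + 2 * n0) * q \<le> (2 * (n1 * n0) + n1 * n) * q"
  proof (rule mult_right_mono)
    show "9 / 16 * (9 / 4 + n1 + 2 * n0) \<le> 2 * (n1 * n0) + n1 * n"
      using p n unfolding distrib_left by linarith
  qed (rule q)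
  have "(9 / 4 + n1 + 2 * n0)\<^sup>2 * (9 / 64) \<le> (13 / 4 * n1 + 2 * n0)\<^sup>2 * (9 / 64)"
    using n by (intro mult_right_mono power_mono) auto
  also have "\<dots> \<le> (n1 * n0)\<^sup>2 + 3 * (n1 * n1 * n0)"
  proof -
    have a: "n1 * n0 \<le> n1 * n1 * n0" "n1 * n1 \<le> n1 * n1 * n0"
      using n mult_mono[of 1 n1 "n1 * n0" "n1 * n0"] mult_mono[of "n1 * n1" "n1 * n1" 1 n0]
      by (auto simp: mult.assoc)
    have b: "n0 * n0 \<le> (n1 * n0) * (n1 * n0)" "n1 * n1 \<le> (n1 * n0) * (n1 * n0)"
      using mult_mono[OF p(1) p(1)] mult_mono[OF p(2) p(2)] n by simp_all
    have "(13 / 4 * n1 + 2 * n0)\<^sup>2 * (9 / 64)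
        = 1521 / 1024 * (n1 * n1) + 117 / 64 * (n1 * n0) + 9 / 16 * (n0 * n0)"
      by (simp add: power2_eq_square algebra_simps)
    then show ?thesis using a b zero_le_square[of n1] unfolding power2_eq_square by linarith
  qed
  also have "\<dots> \<le> (n1 * n0)\<^sup>2 + 3 * (n1 * n * (n1 * n0))"
  proof -
    have "n1 * n0 * n1 \<le> n1 * n0 * (n1 * n)" using p n by (intro mult_left_mono) auto
    then show ?thesis by (simp add: algebra_simps)
  qed
  finally have "(9 / 4 + n1 + 2 * n0)\<^sup>2 * (9 / 64) * q\<^sup>2 \<le> ((n1 * n0)\<^sup>2 + 3 * (n1 * n * (n1 * n0))) * q\<^sup>2"
    by (intro mult_right_mono) auto
  with lin show ?thesis by (simp add: power2_eq_square algebra_simps)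
qed

text \<open>Where the smoothing is active its curvature is smaller by the factor \<open>1 - x\<close>, but then the term
  \<open>8 * lam2\<close>, of size at least \<open>32 * n1 * n0\<^sup>2 * x\<^sup>2 / m\<^sup>2\<close>, compensates the loss.\<close>
lemma unsaturated_constant:
  fixes n n0 m x K G :: real and k :: nat
  defines "n1 \<equiv> real k"
  assumes n: "1 \<le> n" "1 \<le> n0" "1 \<le> k" and m: "0 < m" "n1 * m\<^sup>2 + m \<le> 1" and x: "x \<le> 1"
    and G: "(1 + n1 * n0 * (m\<^sup>2 / n))\<^sup>2 + n1 * m\<^sup>2 * (1 + 3 * (n1 * n0 * (m\<^sup>2 / n))) \<le> G\<^sup>2" "0 \<le> G"
    and K: "32 * n1 * n0\<^sup>2 * x\<^sup>2 / m\<^sup>2 + 2 * (1 - x) * G \<le> K"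
  shows "3 / 4 * ((9 / 4 + n1 + 2 * n0) * (m\<^sup>2 / n) + 2) \<le> K"
proof -
  define q where "q = m\<^sup>2 / n"
  define B where "B = n1 * m\<^sup>2"
  define A where "A = n1 * n0 * q"
  have n1: "1 \<le> n1" using n by (simp add: n1_def)
  have q: "0 \<le> q" "q \<le> m\<^sup>2" using n m by (auto simp: q_def divide_le_eq_1 field_simps mult_le_cancel_right1)
  have qn: "n * q = m\<^sup>2" using n by (simp add: q_def)
  have B: "0 \<le> B" "B \<le> 1" "B = n1 * n * q" using m n1 qn by (auto simp: B_def)
  have A: "0 \<le> A" using n n1 q by (simp add: A_def)
  \<comment> \<open>0.41 lies just below \<open>sqrt 2 - 1\<close>, so that
    \<open>2 * 0.41 + 0.41\<^sup>2 <= 1\<close>, which together with \<open>B <= 1\<close>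
    suffices.\<close>
  have "(1 + A + 41 / 100 * B)\<^sup>2 \<le> (1 + A)\<^sup>2 + B * (1 + 3 * A)"
  proof -
    have "82 / 100 * (1 + A) + 1681 / 10000 * B \<le> 1 + 3 * A"
      using A B(2) unfolding distrib_left by linarith
    then have "B * (82 / 100 * (1 + A) + 1681 / 10000 * B) \<le> B * (1 + 3 * A)"
      using B(1) by (intro mult_left_mono)
    then show ?thesis by (simp add: power2_eq_square algebra_simps add_divide_distrib)
  qed
  then have "(1 + A + 41 / 100 * B)\<^sup>2 \<le> G\<^sup>2" using G(1) unfolding A_def B_def q_def by simp
  then have G': "1 + A + 41 / 100 * B \<le> G" using G(2) by (rule power2_le_imp_le)
  define g where "g = 2 + 2 * A + 82 / 100 * B"
  have "(1 - x) * (2 * (1 + A + 41 / 100 * B)) \<le> (1 - x) * (2 * G)" using x G' by (intro mult_left_mono) auto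
  then have K': "32 * n1 * n0\<^sup>2 * x\<^sup>2 / m\<^sup>2 + (1 - x) * g \<le> K"
    using K by (simp add: g_def algebra_simps)
  define need where "need = 3 / 4 * ((9 / 4 + n1 + 2 * n0) * q + 2)"
  \<comment> \<open>Apart from the quadratic term, the lower bound at \<open>x = 0\<close> exceeds
    the requirement by \<open>g - need\<close>. The loss \<open>x * g\<close> is covered by the
    quadratic term and this slack, by completing a square. For \<open>k = 1\<close> the slack is
    small and the constraint on \<open>m\<close> has to be used numerically.\<close>
  have x_case: "x * g \<le> 32 * n1 * n0\<^sup>2 * x\<^sup>2 / m\<^sup>2 + (g - need)"
  proof (cases "k = 1")
    case True
    then have n1_1: "n1 = 1" by (simp add: n1_def)
    \<comment> \<open>The constraint is \<open>m\<^sup>2 + m <= 1\<close>, so \<open>m\<close> is at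
      most \<open>(sqrt 5 - 1) / 2\<close>, about 0.618. The square of 0.624 is still below
      0.39.\<close>
    have "m \<le> 0.624" 
    proof (rule ccontr)
      assume "\<not> m \<le> 0.624"
      then have "0.624 * 0.624 \<le> m * m" using m by (intro mult_mono) auto
      then show False using m \<open>\<not> m \<le> 0.624\<close> by (simp add: n1_1 power2_eq_square)
    qed
    then have mm: "m\<^sup>2 \<le> 0.39" using m mult_mono[of m "0.624" m "0.624"] by (simp add: power2_eq_square)
    have "1 * q \<le> n0 * q" "1 * q \<le> n * q" using n q mult_right_mono[of 1 n0 q] mult_right_mono[of 1 n q] by simp_all
    then have gap: "64 / 1000 \<le> g - need"
      using q mm by (simp add: g_def need_def A_def B(3) n1_1 algebra_simps)
    have "n0 * q \<le> n0 * 0.39" using n q mm by (intro mult_left_mono) auto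
    then have "g \<le> 2 + 0.78 * n0 + 0.32" using mm by (simp add: g_def A_def B_def n1_1)
    then have gle: "g \<le> 3.1 * n0" using n by simp
    have g0: "0 \<le> g" using A B by (simp add: g_def)
    have "x * g \<le> \<bar>x\<bar> * (3.1 * n0)" using gle g0 mult_mono[of x "\<bar>x\<bar>" g "3.1 * n0"] by auto
    also have "\<dots> = 3.1 * (n0 * \<bar>x\<bar>)" by simp
    \<comment> \<open>82 is the largest integer whose product with 0.39 stays below 32, and
      \<open>31 / 1640\<close> is the vertex of \<open>82 * y\<^sup>2 - 3.1 * y\<close>.\<close>
    also have "\<dots> \<le> 82 * (n0 * \<bar>x\<bar>)\<^sup>2 + 64 / 1000"
    proof -
      have "0 \<le> (n0 * \<bar>x\<bar> - 31 / 1640)\<^sup>2" by simp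
      then show ?thesis by (simp add: power2_eq_square algebra_simps)
    qed
    also have "82 * (n0 * \<bar>x\<bar>)\<^sup>2 \<le> 32 * n1 * n0\<^sup>2 * x\<^sup>2 / m\<^sup>2"
    proof -
      have "82 * (n0\<^sup>2 * x\<^sup>2) * m\<^sup>2 \<le> 82 * (n0\<^sup>2 * x\<^sup>2) * 0.39" using mm by (intro mult_left_mono) auto
      also have "\<dots> \<le> 32 * (n0\<^sup>2 * x\<^sup>2)" by (simp add: mult_right_mono)
      finally show ?thesis using m by (simp add: n1_1 power_mult_distrib field_simps)
    qed
    finally show ?thesis using gap by simp
  next
    case False
    then have n1_2: "2 \<le> n1" using n by (simp add: n1_def)
    have "3 / 2 * n0 + 27 / 16 + 3 / 4 * n1 \<le> 2 * n1 * n0 + 82 / 100 * (n1 * n)"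
    proof -
      have "0 \<le> (n1 - 2) * (n0 - 1)" "0 \<le> (n1 - 2) * (n - 1)" using n1_2 n by auto
      then show ?thesis using n n1_2 by (simp add: algebra_simps)
    qed
    then have "(3 / 2 * n0 + 27 / 16 + 3 / 4 * n1) * q \<le> (2 * n1 * n0 + 82 / 100 * (n1 * n)) * q"
      using q by (intro mult_right_mono) auto
    then have gap: "1 / 2 \<le> g - need" by (simp add: g_def need_def A_def B(3) algebra_simps)
    have "n0 * (n1 * q) \<le> n0 * (n1 * m\<^sup>2)" using n n1 q by (intro mult_left_mono) auto
    then have "A \<le> n0 * B" by (simp add: A_def B_def algebra_simps)
    moreover have "n0 * B \<le> n0 * 1" using n B by (intro mult_left_mono) auto
    ultimately have "g \<le> 2 + 2 * n0 + 82 / 100" using B(2) unfolding g_def by linarith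
    then have gle: "g \<le> 4.82 * n0" using n by simp
    have g0: "0 \<le> g" using A B by (simp add: g_def)
    have "x * g \<le> \<bar>x\<bar> * (4.82 * n0)" using gle g0 mult_mono[of x "\<bar>x\<bar>" g "4.82 * n0"] by auto
    also have "\<dots> = 4.82 * (n0 * \<bar>x\<bar>)" by simp
    \<comment> \<open>\<open>241 / 6400\<close> is the vertex of
      \<open>64 * y\<^sup>2 - 4.82 * y\<close>.\<close>
    also have "\<dots> \<le> 64 * (n0 * \<bar>x\<bar>)\<^sup>2 + 1 / 2"
    proof -
      have "0 \<le> (n0 * \<bar>x\<bar> - 241 / 6400)\<^sup>2" by simp
      then show ?thesis by (simp add: power2_eq_square algebra_simps)
    qed
    also have "64 * (n0 * \<bar>x\<bar>)\<^sup>2 \<le> 32 * n1 * n0\<^sup>2 * x\<^sup>2 / m\<^sup>2"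
    proof -
      have "2 * m\<^sup>2 \<le> n1 * m\<^sup>2" using n1_2 by (intro mult_right_mono) auto
      then have "2 * m\<^sup>2 \<le> n1" using B(2) n1_2 unfolding B_def by linarith
      then have "32 * (n0\<^sup>2 * x\<^sup>2) * (2 * m\<^sup>2) \<le> 32 * (n0\<^sup>2 * x\<^sup>2) * n1" by (intro mult_left_mono) auto
      then show ?thesis using m by (simp add: power_mult_distrib field_simps)
    qed
    finally show ?thesis using gap by simp
  qed
  then have "need \<le> K" using K' by (simp add: algebra_simps)
  then show ?thesis by (simp add: need_def q_def)
qed

section \<open>Test points with constant blocks\<close>

context spg_problem
begin

text \<open>With each block constant, all output preactivations coincide and the fidelity gradient
  is governed by three scalars; the data enter it only through their mean
  \<open>xbar\<close>.\<close>

definition block_point :: "real \<Rightarrow> real \<Rightarrow> real \<Rightarrow> nat \<Rightarrow> real" where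
  "block_point w v b k = (if k < N0 * N1 then w else if k < N0 * N1 + N1 then 0
     else if k < N0 * N1 + N1 + N0 then b else if k < M then v else 0)"

lemma block_point_blocks:
  "i < N1 \<Longrightarrow> j < N0 \<Longrightarrow> W (block_point w v b) i j = w"
  "i < N1 \<Longrightarrow> b1 (block_point w v b) i = 0"
  "j < N0 \<Longrightarrow> b2 (block_point w v b) j = b"
  "i < N1 \<Longrightarrow> n < N \<Longrightarrow> V (block_point w v b) i n = v"
proof -
  show "i < N1 \<Longrightarrow> j < N0 \<Longrightarrow> W (block_point w v b) i j = w"
    using index_less[of i j] by (simp add: blocks block_point_def)
  show "V (block_point w v b) i n = v" if "i < N1" "n < N"
  proof -
    have "n * N1 + i < Suc n * N1" using that by simp
    also have "\<dots> \<le> N * N1" using that by (intro mult_right_mono) auto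
    finally show ?thesis by (simp add: blocks block_point_def dimz_def mult.commute)
  qed
qed (auto simp: blocks block_point_def)

lemma block_point_supp: "block_point w v b \<in> supp M"
  by (auto simp: supp_def block_point_def dimz_def)

lemma block_point_abs_le: "\<bar>w\<bar> \<le> a \<Longrightarrow> \<bar>v\<bar> \<le> a \<Longrightarrow> \<bar>b\<bar> \<le> a \<Longrightarrow> \<bar>block_point w v b k\<bar> \<le> a"
  using abs_ge_zero[of w] by (auto simp: block_point_def simp del: abs_ge_zero)

lemma sqnorm_block_point: "sqnorm M (block_point w v b) = real N1 * real N0 * w\<^sup>2 + real N0 * b\<^sup>2 + real N * real N1 * v\<^sup>2"
proof -
  have "sqnorm M z = normW z + (\<Sum>i<N1. (b1 z i)\<^sup>2) + (\<Sum>j<N0. (b2 z j)\<^sup>2) + normV z" for z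
    unfolding sqnorm_def sum_coord_blocks normW_def normV_def blocks by simp
  then show ?thesis by (simp add: normW_def normV_def block_point_blocks)
qed

lemma out_block_point: "j < N0 \<Longrightarrow> n < N \<Longrightarrow> out (block_point w v b) j n = real N1 * w * v + b"
  by (simp add: pre2_def block_point_blocks)

lemma dout_block_point: "j < N0 \<Longrightarrow> n < N \<Longrightarrow>
    dout (block_point w v b) (block_point s t r) j n = real N1 * (s * v + w * t) + r"
  by (simp add: dout_def block_point_blocks algebra_simps)

lemma hid_block_point: "i < N1 \<Longrightarrow> hid (block_point w v b) i n = (\<Sum>j<N0. w * X j n)"
  by (simp add: pre1_def block_point_blocks)

definition xbar :: real where
  "xbar = (\<Sum>n<N. \<Sum>j<N0. X j n) / (real N * real N0)"

lemma sum_X: "(\<Sum>n<N. \<Sum>j<N0. X j n) = real N * real N0 * xbar"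
  using dims by (simp add: xbar_def)

text \<open>The variance of the entries of \<open>X\<close> is nonnegative, and \<open>theta\<close>
  exceeds \<open>frob2 N N0 X / real N\<close>.\<close>

lemma xbar_sq_le: "real N0 * xbar\<^sup>2 \<le> theta"
proof -
  have "0 \<le> (\<Sum>n<N. \<Sum>j<N0. (X j n - xbar)\<^sup>2)" by (intro sum_nonneg) auto
  also have "\<dots> = (\<Sum>n<N. \<Sum>j<N0. (X j n)\<^sup>2) - 2 * xbar * (\<Sum>n<N. \<Sum>j<N0. X j n) + real N * real N0 * xbar\<^sup>2"
    by (simp add: power2_diff sum.distrib sum_subtractf sum_distrib_left algebra_simps)
  also have "\<dots> = frob2 N N0 X - real N * real N0 * xbar\<^sup>2"
    unfolding sum_X frob2_def by (subst sum.swap) (simp add: power2_eq_square algebra_simps)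
  finally have "real N0 * xbar\<^sup>2 \<le> frob2 N N0 X / real N" using dims by (simp add: field_simps)
  then show ?thesis using theta by simp
qed

lemma norm1_bounds: "0 \<le> norm1 N N0 X" "xbar \<le> norm1 N N0 X"
proof -
  have ge: "(\<Sum>j<N0. \<bar>X j n\<bar>) \<le> norm1 N N0 X" if "n < N" for n
    unfolding norm1_def using that by (intro Max_ge) auto
  show n0: "0 \<le> norm1 N N0 X" using order_trans[OF sum_nonneg ge[of 0]] dims(1) by simp
  have "(\<Sum>n<N. \<Sum>j<N0. X j n) \<le> (\<Sum>n<N. norm1 N N0 X)"
  proof (rule sum_mono)
    fix n assume "n \<in> {..<N}"
    then show "(\<Sum>j<N0. X j n) \<le> norm1 N N0 X" using order_trans[OF sum_mono ge[of n]] by simp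
  qed
  then have "real N0 * xbar \<le> norm1 N N0 X" unfolding sum_X using dims by simp
  \<comment> \<open>Enlarging \<open>norm1\<close> by the factor \<open>real N0\<close> allows
    cancelling that factor whatever the sign of \<open>xbar\<close>.\<close>
  moreover have "1 * norm1 N N0 X \<le> real N0 * norm1 N N0 X" using n0 dims by (intro mult_right_mono) auto
  ultimately have "real N0 * xbar \<le> real N0 * norm1 N N0 X" by linarith
  then show "xbar \<le> norm1 N N0 X" using dims by simp
qed

lemma eta_bounds:
  "0 < et" "real N1 * real N0 * theta \<le> lam2 * et\<^sup>2" "theta \<le> lam1 * et"
proof -
  have "0 < theta / lam1" using theta_pos lam by simp
  moreover have e: "theta / lam1 \<le> et" "sqrt (real N1 * real N0 * theta / lam2) \<le> et" by (auto simp: eta_def)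
  ultimately show et: "0 < et" by linarith
  show "theta \<le> lam1 * et" using e(1) lam by (simp add: field_simps)
  have "real N1 * real N0 * theta / lam2 \<le> et\<^sup>2"
    using e(2) real_le_lsqrt sqrt_le_D by blast
  then show "real N1 * real N0 * theta \<le> lam2 * et\<^sup>2" using lam by (simp add: field_simps)
qed

lemma norm1_le_alpha: "norm1 N N0 X \<le> alph"
  using lam theta_pos unfolding alpha_def by (intro max.coboundedI2) simp

definition radius :: real where "radius = max alph (2 * et)"

lemma radius_bounds: "0 < radius" "2 * et \<le> radius" "0 \<le> alph" "alph \<le> radius" "xbar \<le> radius"
  using eta_bounds(1) norm1_bounds norm1_le_alpha by (auto simp: radius_def)

text \<open>The Lipschitz bound for two points that differ only in V and b2, paired with
  \<open>block_point s t r\<close> by Cauchy-Schwarz. The penalty part of the differential sees the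
  base point only through \<open>hid\<close>, hence through W and b1, and cancels in the
  difference.\<close>

lemma gradient_secant:
  fixes LG :: real
  assumes LG: "\<And>z1 m1 z2 m2. z1 \<in> supp M \<Longrightarrow> z2 \<in> supp M \<Longrightarrow>
      (\<forall>i<M. \<bar>z1 i\<bar> \<le> radius) \<Longrightarrow> (\<forall>i<M. \<bar>z2 i\<bar> \<le> radius) \<Longrightarrow> m1 \<in> {0<..<1} \<Longrightarrow> m2 \<in> {0<..<1} \<Longrightarrow>
      sqrt (sqnorm M (\<lambda>i. m1 * gH z1 m1 i - m2 * gH z2 m2 i)) \<le> LG * distzm M z1 m1 z2 m2"
    and m: "0 < m" "m < 1" and bnd: "\<bar>w\<bar> \<le> radius" "\<bar>v\<bar> \<le> radius" "\<bar>v'\<bar> \<le> radius" "\<bar>b\<bar> \<le> radius" "\<bar>b'\<bar> \<le> radius"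
  shows "2 / real N * ((\<Sum>n<N. \<Sum>j<N0. m * resid (block_point w v b) m j n) * (real N1 * (s * v + w * t) + r)
      - (\<Sum>n<N. \<Sum>j<N0. m * resid (block_point w v' b') m j n) * (real N1 * (s * v' + w * t) + r))
    \<le> LG * sqrt (real N0 * (b - b')\<^sup>2 + real N * real N1 * (v - v')\<^sup>2)
        * sqrt (real N1 * real N0 * s\<^sup>2 + real N0 * r\<^sup>2 + real N * real N1 * t\<^sup>2)"
proof -
  let ?z = "block_point w v b" and ?z' = "block_point w v' b'" and ?p = "block_point s t r"
  let ?g = "\<lambda>i. m * gH ?z m i - m * gH ?z' m i"
  have hid: "(\<Sum>n<N. \<Sum>i<N1. V ?p i n - dsig (hid ?z i n) m * hid ?p i n)
      = (\<Sum>n<N. \<Sum>i<N1. V ?p i n - dsig (hid ?z' i n) m * hid ?p i n)"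
    by (simp add: hid_block_point)
  have dist: "distzm M ?z m ?z' m = sqrt (real N0 * (b - b')\<^sup>2 + real N * real N1 * (v - v')\<^sup>2)"
  proof -
    have "(\<lambda>i. ?z i - ?z' i) = block_point 0 (v - v') (b - b')" by (auto simp: block_point_def fun_eq_iff)
    then show ?thesis by (simp add: distzm_def sqnorm_block_point)
  qed
  have eq: "innerz M ?g ?p = m * dH ?z m ?p - m * dH ?z' m ?p"
    unfolding innerz_gradH[OF m(1) block_point_supp, symmetric]
    by (simp add: innerz_def algebra_simps sum_subtractf sum_distrib_left)
  have eq': "m * dH ?z m ?p - m * dH ?z' m ?p = 2 / real N * ((\<Sum>n<N. \<Sum>j<N0. m * resid ?z m j n) * (real N1 * (s * v + w * t) + r)
      - (\<Sum>n<N. \<Sum>j<N0. m * resid ?z' m j n) * (real N1 * (s * v' + w * t) + r))"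
  proof -
    have "m * (\<Sum>n<N. \<Sum>j<N0. resid (block_point w a c) m j n * dout (block_point w a c) ?p j n)
        = (\<Sum>n<N. \<Sum>j<N0. m * resid (block_point w a c) m j n) * (real N1 * (s * a + w * t) + r)" for a c
      by (simp add: dout_block_point sum_distrib_left sum_distrib_right mult.assoc)
    note e = this
    show ?thesis unfolding dH_def hid e[symmetric] by (simp add: algebra_simps)
  qed
  have "innerz M ?g ?p \<le> sqrt (sqnorm M ?g) * sqrt (sqnorm M ?p)"
  proof -
    have "(innerz M ?g ?p)\<^sup>2 \<le> sqnorm M ?g * sqnorm M ?p"
      unfolding innerz_def sqnorm_def by (rule Cauchy_Schwarz_ineq_sum)
    then have "\<bar>innerz M ?g ?p\<bar> \<le> sqrt (sqnorm M ?g * sqnorm M ?p)" using real_le_rsqrt by fastforce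
    then show ?thesis by (simp add: real_sqrt_mult)
  qed
  also have "\<dots> \<le> LG * distzm M ?z m ?z' m * sqrt (sqnorm M ?p)"
    using m bnd by (intro mult_right_mono LG) (auto simp: block_point_supp block_point_abs_le sqnorm_def sum_nonneg)
  finally show ?thesis unfolding eq eq' dist sqnorm_block_point .
qed

text \<open>Near the corner the residual sum is affine in the preactivation, with slope proportional
  to \<open>1 - e - x\<close>. The secant bounds at \<open>mu = 1 - e\<close> then turn into a
  second-derivative bound as \<open>e\<close> tends to 0.\<close>

lemma Lipschitz_lower_bound:
  fixes LG U bb x :: real
  defines "A \<equiv> real N1 * real N0 * (radius\<^sup>2 / real N)" and "B \<equiv> real N1 * radius\<^sup>2"
  assumes LG: "\<And>z1 m1 z2 m2. z1 \<in> supp M \<Longrightarrow> z2 \<in> supp M \<Longrightarrow>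
      (\<forall>i<M. \<bar>z1 i\<bar> \<le> radius) \<Longrightarrow> (\<forall>i<M. \<bar>z2 i\<bar> \<le> radius) \<Longrightarrow> m1 \<in> {0<..<1} \<Longrightarrow> m2 \<in> {0<..<1} \<Longrightarrow>
      sqrt (sqnorm M (\<lambda>i. m1 * gH z1 m1 i - m2 * gH z2 m2 i)) \<le> LG * distzm M z1 m1 z2 m2"
    and bb: "0 \<le> bb" "bb \<le> radius" and x: "x \<le> 1" and U: "B \<le> U"
    and resid: "\<forall>\<^sub>F e in at_right 0. \<forall>v b. b \<le> bb \<longrightarrow> bb - e \<le> b \<longrightarrow> v \<le> radius \<longrightarrow> radius - radius * e \<le> v \<longrightarrow>
      (\<Sum>n<N. \<Sum>j<N0. (1 - e) * resid (block_point radius v b) (1 - e) j n)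
        = real N * real N0 * ((1 - e - x) * (U - real N1 * radius * (radius - v) - (bb - b)))"
  shows "2 * (1 - x) * sqrt ((1 + A)\<^sup>2 + B * (1 + 3 * A)) \<le> LG"
proof -
  have N: "1 \<le> real N" "1 \<le> real N0" "1 \<le> real N1" using dims by (simp_all add: Suc_le_eq)
  have A0: "0 \<le> A" and B0: "0 \<le> B" by (simp_all add: A_def B_def)
  have AB: "real N0 * B / real N = A" by (simp add: A_def B_def field_simps)
  define Y where "Y = B * (1 + 2 * A)\<^sup>2 + (1 + A) ^ 3"
  define d where "d = (1 + A) / real N0"
  define g where "g = B * (1 + 2 * A) / real N"
  define E where "E = B * (1 + 2 * A) + (1 + A)\<^sup>2"
  have Y: "0 < Y" using A0 B0 unfolding Y_def by (intro add_nonneg_pos) auto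
  have d: "0 < d" using A0 N by (simp add: d_def)
  have fund: "2 * real N0 * ((1 - e - x) * (d * E + g * U - e * (d * g))) \<le> LG * sqrt d * sqrt (real N0 * Y)"
    if e: "0 < e" "e < 1" "e \<le> radius" and R: "\<And>v b. b \<le> bb \<Longrightarrow> bb - e \<le> b \<Longrightarrow> v \<le> radius \<Longrightarrow> radius - radius * e \<le> v \<Longrightarrow>
      (\<Sum>n<N. \<Sum>j<N0. (1 - e) * resid (block_point radius v b) (1 - e) j n)
        = real N * real N0 * ((1 - e - x) * (U - real N1 * radius * (radius - v) - (bb - b)))" for e
  proof -
    \<comment> \<open>V and b2 move by \<open>- e\<close> times the gradient of the mean of
      \<open>out\<close>, which lowers \<open>out\<close> by \<open>e * d\<close> at squared
      distance \<open>e\<^sup>2 * d\<close>.\<close>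
    define v where "v = radius - radius * (e / real N)"
    define b where "b = bb - e / real N0"
    \<comment> \<open>Up to scaling, \<open>(s, t, r)\<close> is the rate of change of the fidelity
      gradient along this displacement when \<open>U = B\<close>; in that case Cauchy-Schwarz loses
      nothing in the limit.\<close>
    define s where "s = radius * (1 + 2 * A)"
    define t where "t = real N0 * radius / real N * (1 + A)"
    define r where "r = 1 + A"
    have eN: "0 \<le> e / real N" "e / real N \<le> e" "0 \<le> e / real N0" "e / real N0 \<le> e"
      using e N by (auto simp: divide_le_eq mult_le_cancel_left1)
    have v: "v \<le> radius" "radius - radius * e \<le> v" "0 \<le> v"
      using eN radius_bounds(1) e mult_left_mono[of "e / real N" e radius] mult_left_mono[of "e / real N" 1 radius]
      by (auto simp: v_def)
    have b: "b \<le> bb" "bb - e \<le> b" "\<bar>b\<bar> \<le> radius" using eN e bb unfolding b_def by linarith+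
    have u: "real N1 * radius * (radius - v) + (bb - b) = e * d"
      using N by (simp add: v_def b_def d_def A_def power2_eq_square field_simps)
    have E0: "real N1 * (s * radius + radius * t) + r = E"
    proof -
      have "real N1 * (radius * t) = A * (1 + A)" by (simp add: t_def A_def power2_eq_square)
      moreover have "real N1 * (s * radius) = B * (1 + 2 * A)" by (simp add: s_def B_def power2_eq_square)
      ultimately show ?thesis by (simp add: r_def E_def distrib_left power2_eq_square algebra_simps)
    qed
    have E1: "real N1 * (s * v + radius * t) + r = E - e * g"
      unfolding E0[symmetric] by (simp add: s_def v_def g_def B_def power2_eq_square algebra_simps add_divide_distrib)
    have dist: "real N0 * (bb - b)\<^sup>2 + real N * real N1 * (radius - v)\<^sup>2 = e\<^sup>2 * d"
    proof -
      have "real N0 * (bb - b)\<^sup>2 = e\<^sup>2 * (1 / real N0)"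
        using N by (simp add: b_def power_divide power2_eq_square)
      moreover have "real N * real N1 * (radius - v)\<^sup>2 = e\<^sup>2 * (real N1 * radius\<^sup>2 / real N)"
        using N by (simp add: v_def power_divide power_mult_distrib power2_eq_square)
      moreover have "d = 1 / real N0 + real N1 * radius\<^sup>2 / real N"
        using N by (simp add: d_def A_def add_divide_distrib)
      ultimately show ?thesis by (simp add: distrib_left)
    qed
    have p: "real N1 * real N0 * s\<^sup>2 + real N0 * r\<^sup>2 + real N * real N1 * t\<^sup>2 = real N0 * Y"
    proof -
      have "real N * real N1 * t\<^sup>2 = real N0 * (A * (1 + A)\<^sup>2)"
        using N by (simp add: t_def A_def power2_eq_square field_simps)
      then show ?thesis
        by (simp add: s_def r_def Y_def B_def power2_eq_square power3_eq_cube algebra_simps)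
    qed
    have R1: "(\<Sum>n<N. \<Sum>j<N0. (1 - e) * resid (block_point radius v b) (1 - e) j n)
        = real N * real N0 * ((1 - e - x) * (U - e * d))"
      unfolding R[OF b(1,2) v(1,2)] u[symmetric] by simp
    have R0: "(\<Sum>n<N. \<Sum>j<N0. (1 - e) * resid (block_point radius radius bb) (1 - e) j n)
        = real N * real N0 * ((1 - e - x) * U)"
      using e(1) radius_bounds(1) by (subst R) simp_all
    have bnd: "\<bar>radius\<bar> \<le> radius" "\<bar>v\<bar> \<le> radius" "\<bar>bb\<bar> \<le> radius" "\<bar>b\<bar> \<le> radius" "0 < 1 - e" "1 - e < 1"
      using v b bb radius_bounds(1) e by auto
    have *: "2 / real N * (real N * real N0 * ((1 - e - x) * U) * E
        - real N * real N0 * ((1 - e - x) * (U - e * d)) * (E - e * g))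
      \<le> LG * sqrt (e\<^sup>2 * d) * sqrt (real N0 * Y)"
      by (rule gradient_secant[of LG "1 - e" radius radius v bb b s t r, unfolded R1 R0 E0 E1 dist p])
        (rule LG bnd; assumption?)+
    have "e * (2 * real N0 * ((1 - e - x) * (d * E + g * U - e * (d * g))))
      \<le> e * (LG * sqrt d * sqrt (real N0 * Y))"
    proof -
      define c where "c = (1 - e - x) * (d * E + g * U - e * (d * g))"
      have "real N * real N0 * ((1 - e - x) * U) * E - real N * real N0 * ((1 - e - x) * (U - e * d)) * (E - e * g)
          = real N * (real N0 * (e * c))"
        unfolding c_def by algebra
      then have l: "2 / real N * (real N * real N0 * ((1 - e - x) * U) * E
          - real N * real N0 * ((1 - e - x) * (U - e * d)) * (E - e * g)) = e * (2 * real N0 * c)"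
        using N by simp
      have r: "LG * sqrt (e\<^sup>2 * d) * sqrt (real N0 * Y) = e * (LG * sqrt d * sqrt (real N0 * Y))"
        using e by (simp add: real_sqrt_mult)
      show ?thesis using * unfolding l r c_def .
    qed
    then show ?thesis using e by simp
  qed
  obtain e0 where e0: "0 < e0" and R: "\<And>e v b. 0 < e \<Longrightarrow> e < e0 \<Longrightarrow> b \<le> bb \<Longrightarrow> bb - e \<le> b \<Longrightarrow> v \<le> radius \<Longrightarrow> radius - radius * e \<le> v \<Longrightarrow>
      (\<Sum>n<N. \<Sum>j<N0. (1 - e) * resid (block_point radius v b) (1 - e) j n)
        = real N * real N0 * ((1 - e - x) * (U - real N1 * radius * (radius - v) - (bb - b)))"
    using resid unfolding eventually_at_right_field by auto
  have "2 * real N0 * ((1 - 0 - x) * (d * E + g * U - 0 * (d * g))) \<le> LG * sqrt d * sqrt (real N0 * Y)"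
    by (rule le_of_eventually_le[where tt = "min e0 (min 1 radius)"], intro continuous_intros)
      (use e0 radius_bounds(1) fund R in auto)
  moreover have "Y \<le> real N0 * (d * E + g * U)"
  proof -
    have "g * B \<le> g * U" using U B0 A0 by (intro mult_left_mono) (auto simp: g_def)
    then have "real N0 * (d * E + g * B) \<le> real N0 * (d * E + g * U)" using N by simp
    moreover have "real N0 * (g * B) = A * (1 + 2 * A) * B" unfolding AB[symmetric] g_def by simp
    moreover have "real N0 * (d * E) = (1 + A) * E" using N by (simp add: d_def)
    ultimately show ?thesis
      by (simp add: Y_def E_def power2_eq_square power3_eq_cube algebra_simps)
  qed
  then have "(1 - x) * Y \<le> (1 - x) * (real N0 * (d * E + g * U))" using x by (intro mult_left_mono) auto
  ultimately have "2 * (1 - x) * Y \<le> LG * sqrt d * sqrt (real N0 * Y)" by (simp add: algebra_simps)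
  also have "\<dots> = LG * sqrt (1 + A) * sqrt Y"
    using N by (simp add: d_def real_sqrt_mult real_sqrt_divide)
  finally have "(2 * (1 - x) * sqrt Y) * sqrt Y \<le> (LG * sqrt (1 + A)) * sqrt Y"
    using Y by (simp add: mult.assoc)
  then have sq: "2 * (1 - x) * sqrt Y \<le> LG * sqrt (1 + A)" using Y by simp
  \<comment> \<open>The two sides differ by \<open>B * A\<^sup>2\<close>.\<close>
  have "(1 + A) * ((1 + A)\<^sup>2 + B * (1 + 3 * A)) \<le> Y"
  proof -
    have "0 \<le> B * (A * A)" using A0 B0 by simp
    then show ?thesis by (simp add: Y_def power2_eq_square power3_eq_cube algebra_simps)
  qed
  then have "sqrt (1 + A) * sqrt ((1 + A)\<^sup>2 + B * (1 + 3 * A)) \<le> sqrt Y"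
    by (simp add: real_sqrt_mult[symmetric])
  then have "2 * (1 - x) * (sqrt (1 + A) * sqrt ((1 + A)\<^sup>2 + B * (1 + 3 * A))) \<le> 2 * (1 - x) * sqrt Y"
    using x by (intro mult_left_mono) auto
  then have "(2 * (1 - x) * sqrt ((1 + A)\<^sup>2 + B * (1 + 3 * A))) * sqrt (1 + A) \<le> LG * sqrt (1 + A)"
    using sq by (simp add: algebra_simps)
  then show ?thesis using A0 by simp
qed

text \<open>If \<open>B + radius\<close> exceeds 1, the corner with output bias
  \<open>radius\<close> is saturated: \<open>dsig\<close> is 1 and the data only shift the residual.
  Otherwise the corner with output bias 0 lies where \<open>dsig\<close> is linear; there the data
  change the curvature by the factor \<open>1 - xbar\<close>, and \<open>8 * lam2\<close> makes up
  for a loss.\<close>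

lemma step_constant:
  fixes LG :: real
  assumes LG: "\<And>z1 m1 z2 m2. z1 \<in> supp M \<Longrightarrow> z2 \<in> supp M \<Longrightarrow>
      (\<forall>i<M. \<bar>z1 i\<bar> \<le> radius) \<Longrightarrow> (\<forall>i<M. \<bar>z2 i\<bar> \<le> radius) \<Longrightarrow> m1 \<in> {0<..<1} \<Longrightarrow> m2 \<in> {0<..<1} \<Longrightarrow>
      sqrt (sqnorm M (\<lambda>i. m1 * gH z1 m1 i - m2 * gH z2 m2 i)) \<le> LG * distzm M z1 m1 z2 m2"
  shows "3 / 4 * ((9 / 4 + real N1 + 2 * real N0) * (radius\<^sup>2 / real N) + 2) \<le> 8 * lam2 + LG"
proof -
  define A where "A = real N1 * real N0 * (radius\<^sup>2 / real N)"
  define B where "B = real N1 * radius\<^sup>2"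
  have N: "1 \<le> real N" "1 \<le> real N0" "1 \<le> real N1" using dims by (simp_all add: Suc_le_eq)
  have A0: "0 \<le> A" and B0: "0 \<le> B" by (simp_all add: A_def B_def)
  note lower = Lipschitz_lower_bound[OF LG, folded A_def B_def]
  define G where "G = sqrt ((1 + A)\<^sup>2 + B * (1 + 3 * A))"
  have G: "0 \<le> G" "G\<^sup>2 = (1 + A)\<^sup>2 + B * (1 + 3 * A)" using A0 B0 by (simp_all add: G_def)
  have out: "out (block_point radius v b) j n = B - real N1 * radius * (radius - v) + b" if "j < N0" "n < N" for v b j n
    using that by (simp add: out_block_point B_def power2_eq_square algebra_simps)
  have near: "B + c - e * (B + 1) \<le> B - real N1 * radius * (radius - v) + b"
    if "c - e \<le> b" "radius - radius * e \<le> v" for c b v e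
  proof -
    have "real N1 * radius * (radius - v) \<le> real N1 * radius * (radius * e)"
      using that radius_bounds(1) by (intro mult_left_mono) auto
    then show ?thesis using that by (simp add: B_def power2_eq_square algebra_simps)
  qed
  show ?thesis
  proof (cases "1 < B + radius")
    case True
    have "2 * (1 - 0) * sqrt ((1 + A)\<^sup>2 + B * (1 + 3 * A)) \<le> LG"
    \<comment> \<open>Under saturation the mean residual is \<open>out - xbar\<close>;
      \<open>xbar <= radius\<close> then gives \<open>B <= U\<close>.\<close>
    proof (rule lower[where x = 0 and bb = radius and U = "B + radius - xbar"])
      show "\<forall>\<^sub>F e in at_right 0. \<forall>v b. b \<le> radius \<longrightarrow> radius - e \<le> b \<longrightarrow> v \<le> radius \<longrightarrow> radius - radius * e \<le> v \<longrightarrow>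
        (\<Sum>n<N. \<Sum>j<N0. (1 - e) * resid (block_point radius v b) (1 - e) j n)
        = real N * real N0 * ((1 - e - 0) * (B + radius - xbar - real N1 * radius * (radius - v) - (radius - b)))"
        unfolding eventually_at_right_field
      proof (intro exI conjI allI impI)
        \<comment> \<open>By \<open>near\<close>, \<open>out\<close> drops by at most
          \<open>e * (B + 1)\<close>, so below this threshold it remains at least 1 and thus above
          \<open>mu = 1 - e\<close>.\<close>
        show "0 < min 1 ((B + radius - 1) / (B + 1))" using True B0 by simp
        fix e v b :: real
        assume e: "0 < e" "e < min 1 ((B + radius - 1) / (B + 1))"
          and v: "b \<le> radius" "radius - e \<le> b" "v \<le> radius" "radius - radius * e \<le> v"
        have "e * (B + 1) < B + radius - 1" using e B0 by (simp add: less_divide_eq)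
        then have ge: "1 \<le> B - real N1 * radius * (radius - v) + b" using near[OF v(2,4)] by linarith
        have "(1 - e) * resid (block_point radius v b) (1 - e) j n
            = (1 - e) * (B - real N1 * radius * (radius - v) + b) - (1 - e) * X j n"
          if "n < N" "j < N0" for j n
          using that e ge by (simp add: resid_def out dsig_saturated pos_def right_diff_distrib)
        then have "(\<Sum>n<N. \<Sum>j<N0. (1 - e) * resid (block_point radius v b) (1 - e) j n)
          = real N * real N0 * ((1 - e) * (B - real N1 * radius * (radius - v) + b)) - (1 - e) * (\<Sum>n<N. \<Sum>j<N0. X j n)"
          by (simp add: sum_subtractf sum_distrib_left)
        then show "(\<Sum>n<N. \<Sum>j<N0. (1 - e) * resid (block_point radius v b) (1 - e) j n)
          = real N * real N0 * ((1 - e - 0) * (B + radius - xbar - real N1 * radius * (radius - v) - (radius - b)))"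
          unfolding sum_X by (simp add: algebra_simps)
      qed
    qed (use radius_bounds in auto)
    then have "2 * G \<le> LG" by (simp add: G_def)
    moreover have "3 / 8 * ((9 / 4 + real N1 + 2 * real N0) * (radius\<^sup>2 / real N) + 2) \<le> G"
    proof (rule power2_le_imp_le)
      have "real N1 * real N * (radius\<^sup>2 / real N) = B" using N by (simp add: B_def)
      then show "(3 / 8 * ((9 / 4 + real N1 + 2 * real N0) * (radius\<^sup>2 / real N) + 2))\<^sup>2 \<le> G\<^sup>2"
        using saturated_constant[OF N, of "radius\<^sup>2 / real N"] by (simp add: G A_def)
    qed (rule G)
    ultimately show ?thesis using lam by linarith
  next
    case False
    have x1: "xbar \<le> 1" using False B0 radius_bounds(5) by linarith
    have B1: "B < 1" using False radius_bounds(1) by linarith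
    have "2 * (1 - xbar) * sqrt ((1 + A)\<^sup>2 + B * (1 + 3 * A)) \<le> LG"
    proof (rule lower[where x = xbar and bb = 0 and U = B])
      show "\<forall>\<^sub>F e in at_right 0. \<forall>v b. b \<le> 0 \<longrightarrow> 0 - e \<le> b \<longrightarrow> v \<le> radius \<longrightarrow> radius - radius * e \<le> v \<longrightarrow>
        (\<Sum>n<N. \<Sum>j<N0. (1 - e) * resid (block_point radius v b) (1 - e) j n)
        = real N * real N0 * ((1 - e - xbar) * (B - real N1 * radius * (radius - v) - (0 - b)))"
        unfolding eventually_at_right_field
      proof (intro exI conjI allI impI)
        have "0 < B" using N radius_bounds(1) by (simp add: B_def)
        \<comment> \<open>The bound \<open>1 - B\<close> keeps \<open>out\<close> at most
          \<open>1 - e\<close>, and \<open>B / (B + 1)\<close> keeps it nonnegative.\<close>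
        then show "0 < min (1 - B) (B / (B + 1))" using B1 by simp
        fix e v b :: real
        assume e: "0 < e" "e < min (1 - B) (B / (B + 1))"
          and v: "b \<le> 0" "0 - e \<le> b" "v \<le> radius" "radius - radius * e \<le> v"
        have "e * (B + 1) < B" using e B0 by (simp add: less_divide_eq)
        then have ge: "0 \<le> B - real N1 * radius * (radius - v) + b" using near[OF v(2,4)] by linarith
        have "0 \<le> real N1 * radius * (radius - v)" using v radius_bounds(1) by simp
        then have le: "B - real N1 * radius * (radius - v) + b \<le> 1 - e" using v e by simp
        have e1: "0 < 1 - e" using e B0 by simp
        have "(1 - e) * resid (block_point radius v b) (1 - e) j n
            = (1 - e) * (B - real N1 * radius * (radius - v) + b) - (B - real N1 * radius * (radius - v) + b) * X j n"
          if "n < N" "j < N0" for j n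
          using that e1 ge le by (simp add: resid_def out dsig_linear pos_def right_diff_distrib)
        then have "(\<Sum>n<N. \<Sum>j<N0. (1 - e) * resid (block_point radius v b) (1 - e) j n)
          = real N * real N0 * ((1 - e) * (B - real N1 * radius * (radius - v) + b))
            - (B - real N1 * radius * (radius - v) + b) * (\<Sum>n<N. \<Sum>j<N0. X j n)"
          by (simp add: sum_subtractf sum_distrib_left)
        then show "(\<Sum>n<N. \<Sum>j<N0. (1 - e) * resid (block_point radius v b) (1 - e) j n)
          = real N * real N0 * ((1 - e - xbar) * (B - real N1 * radius * (radius - v) - (0 - b)))"
          unfolding sum_X by (simp add: algebra_simps)
      qed
    qed (use radius_bounds x1 in auto)
    then have lg: "2 * (1 - xbar) * G \<le> LG" by (simp add: G_def)
    have l2: "32 * real N1 * (real N0)\<^sup>2 * xbar\<^sup>2 / radius\<^sup>2 \<le> 8 * lam2"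
    proof -
      have "4 * (real N1 * real N0 * (real N0 * xbar\<^sup>2)) \<le> 4 * (real N1 * real N0 * theta)"
        using xbar_sq_le by (intro mult_left_mono) auto
      also have "\<dots> \<le> 4 * (lam2 * et\<^sup>2)" using eta_bounds(2) by simp
      also have "\<dots> = lam2 * (2 * et)\<^sup>2" by (simp add: power_mult_distrib)
      also have "\<dots> \<le> lam2 * radius\<^sup>2"
        using lam eta_bounds(1) radius_bounds by (intro mult_left_mono power_mono) auto
      finally show ?thesis using radius_bounds(1) by (simp add: power2_eq_square field_simps)
    qed
    show ?thesis
    proof (rule unsaturated_constant[where x = xbar and G = G])
      show "32 * real N1 * (real N0)\<^sup>2 * xbar\<^sup>2 / radius\<^sup>2 + 2 * (1 - xbar) * G \<le> 8 * lam2 + LG"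
        using lg l2 by linarith
    qed (use N dims radius_bounds(1) x1 G False in \<open>auto simp: A_def B_def\<close>)
  qed
qed

end

section \<open>Boundedness and convergence of the iterates\<close>

context spg_problem
begin

text \<open>The first term bounds W and V when the regularizer is small; the second is the box bound
  on the biases, with b2 counted twice as in \<open>Q\<close>.\<close>

definition Qmax :: real where
  "Qmax = 9 * et\<^sup>2 + (real N1 + 2 * real N0) * alph\<^sup>2"

lemma norms_nonneg: "0 \<le> normW z" "0 \<le> normV z"
  by (simp_all add: normW_def normV_def sum_nonneg)

lemma sumV_nonneg: "z \<in> Z \<Longrightarrow> 0 \<le> sumV z"
  unfolding sumV_def using V_nonneg by (intro sum_nonneg) auto

text \<open>The entries of V are nonnegative on \<open>Z\<close>, so their Euclidean norm is at most
  their sum.\<close>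

lemma normV_le: assumes "z \<in> Z" shows "normV z \<le> (sumV z)\<^sup>2"
proof -
  have "V z i n \<le> sumV z" if "n < N" "i < N1" for i n
  proof -
    have "V z i n \<le> (\<Sum>i<N1. V z i n)"
      using V_nonneg[OF assms] that by (intro member_le_sum) auto
    also have "\<dots> \<le> sumV z" unfolding sumV_def
      using V_nonneg[OF assms] that by (intro member_le_sum sum_nonneg) auto
    finally show ?thesis .
  qed
  then have "normV z \<le> (\<Sum>n<N. \<Sum>i<N1. sumV z * V z i n)"
    unfolding normV_def power2_eq_square using V_nonneg[OF assms]
    by (intro sum_mono mult_right_mono) auto
  then show ?thesis by (simp add: sumV_def sum_distrib_left[symmetric] power2_eq_square)
qed

text \<open>\<open>eta\<close> is designed to convert bounds in \<open>theta\<close> into bounds on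
  V and W: here \<open>sumV z <= 3 * et\<close>. The 9 in \<open>Qmax\<close> arises from
  \<open>3 * p + w <= 9 * theta\<close>.\<close>

lemma Q_le_Qmax:
  assumes z: "z \<in> Z" and small: "lam1 * sumV z + 2 * lam2 * normW z \<le> 3 * theta"
  shows "Q z \<le> Qmax"
proof -
  define p where "p = lam1 * sumV z"
  define w where "w = lam2 * normW z"
  have pw: "0 \<le> p" "0 \<le> w" "p + 2 * w \<le> 3 * theta"
    using small lam sumV_nonneg[OF z] norms_nonneg by (auto simp: p_def w_def)
  have V: "theta * normV z \<le> 3 * et\<^sup>2 * p"
  proof -
    have "theta * sumV z \<le> lam1 * et * sumV z"
      using eta_bounds(3) sumV_nonneg[OF z] by (intro mult_right_mono)
    then have s: "theta * sumV z \<le> et * p" by (simp add: p_def mult_ac)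
    also have "\<dots> \<le> et * (3 * theta)" using pw eta_bounds(1) by (intro mult_left_mono) auto
    finally have "sumV z \<le> 3 * et" using theta_pos by (simp add: mult.commute mult.left_commute)
    then have "sumV z * (theta * sumV z) \<le> 3 * et * (et * p)"
      using s sumV_nonneg[OF z] theta_pos eta_bounds(1)
      by (intro mult_mono[of "sumV z" "3 * et" "theta * sumV z" "et * p"]) auto
    moreover have "theta * normV z \<le> theta * (sumV z)\<^sup>2" using normV_le[OF z] theta_pos by simp
    ultimately show ?thesis by (simp add: power2_eq_square mult_ac)
  qed
  have W: "theta * normW z \<le> et\<^sup>2 * w"
  proof -
    have "1 * 1 \<le> real N1 * real N0" using dims by (intro mult_mono) auto
    then have "theta \<le> real N1 * real N0 * theta" using theta_pos by simp
    then have "theta * normW z \<le> lam2 * et\<^sup>2 * normW z"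
      using eta_bounds(2) norms_nonneg by (intro mult_right_mono) auto
    then show ?thesis by (simp add: w_def mult_ac)
  qed
  have "et\<^sup>2 * (3 * p + w) \<le> et\<^sup>2 * (9 * theta)" using pw by (intro mult_left_mono) auto
  then have "theta * (normV z + normW z) \<le> theta * (9 * et\<^sup>2)"
    using V W by (simp add: algebra_simps)
  then have VW: "normV z + normW z \<le> 9 * et\<^sup>2" using theta_pos by simp
  have "\<bar>z (N0 * N1 + i)\<bar> \<le> alph" if "i < N1 + N0" for i
    using Z_memD(2)[OF z] that by (simp add: Omega3_def)
  then have sq: "(z (N0 * N1 + i))\<^sup>2 \<le> alph\<^sup>2" if "i < N1 + N0" for i
    using that radius_bounds(3) abs_le_square_iff by force
  have "(\<Sum>i<N1. (b1 z i)\<^sup>2) \<le> (\<Sum>i<N1. alph\<^sup>2)"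
    unfolding blocks by (intro sum_mono sq) auto
  moreover have "(\<Sum>j<N0. (b2 z j)\<^sup>2) \<le> (\<Sum>j<N0. alph\<^sup>2)"
    unfolding blocks add.assoc by (intro sum_mono sq) auto
  ultimately show ?thesis using VW unfolding Q_blocks Qmax_def by (simp add: algebra_simps)
qed

text \<open>A dichotomy at \<open>z'\<close>: a small regularizer bounds \<open>Q z'\<close>
  outright, while a large one makes the right-hand term of \<open>dissipation\<close> negative, so
  that \<open>Q\<close> does not grow.\<close>

lemma Qmax_invariant:
  assumes mu: "0 < mu" and L: "0 < L" and z: "z \<in> Z" "Q z \<le> Qmax" and z': "z' \<in> Z"
    and opt: "\<And>w. w \<in> Z \<Longrightarrow>
      subobj N N0 N1 X lam1 lam2 beta z mu L z' \<le> subobj N N0 N1 X lam1 lam2 beta z mu L w"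
    and large: "3 / 4 * ((9 / 4 + real N1 + 2 * real N0) * (radius\<^sup>2 / real N) + 2) \<le> L"
  shows "Q z' \<le> Qmax"
proof (cases "lam1 * sumV z' + 2 * lam2 * normW z' \<le> 3 * theta")
  case True
  then show ?thesis using Q_le_Qmax[OF z'] by simp
next
  case False
  have "(2 * et)\<^sup>2 \<le> radius\<^sup>2" "alph\<^sup>2 \<le> radius\<^sup>2"
    using eta_bounds(1) power_mono[OF radius_bounds(2), of 2] power_mono[OF radius_bounds(4,3), of 2] by auto
  \<comment> \<open>The constant 9/4 in the required size of \<open>L\<close> arises here, from
    \<open>2 * et <= radius\<close>.\<close>
  then have "9 * et\<^sup>2 \<le> 9 / 4 * radius\<^sup>2" "(real N1 + 2 * real N0) * alph\<^sup>2 \<le> (real N1 + 2 * real N0) * radius\<^sup>2"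
    by (auto simp: power_mult_distrib intro!: mult_left_mono)
  then have "Qmax \<le> (9 / 4 + real N1 + 2 * real N0) * radius\<^sup>2"
    by (simp add: Qmax_def distrib_right)
  moreover have "normV z + normW z \<le> Q z" unfolding Q_blocks by (simp add: sum_nonneg)
  ultimately have "3 / 4 * (normV z + normW z + 2 * real N)
      \<le> 3 / 4 * ((9 / 4 + real N1 + 2 * real N0) * radius\<^sup>2 + 2 * real N)"
    using z by simp
  also have "\<dots> = real N * (3 / 4 * ((9 / 4 + real N1 + 2 * real N0) * (radius\<^sup>2 / real N) + 2))"
    using dims by (simp add: distrib_left)
  also have "\<dots> \<le> real N * L" using large by (intro mult_left_mono) auto
  finally have "Q z' \<le> Q z + 2 / L * (3 * theta - (lam1 * sumV z' + 2 * lam2 * normW z'))"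
    by (intro dissipation[OF mu L z(1) z' opt])
  also have "2 / L * (3 * theta - (lam1 * sumV z' + 2 * lam2 * normW z')) \<le> 0"
    using False L by (intro mult_nonneg_nonpos) auto
  finally show ?thesis using z by simp
qed

lemma Q_coord: assumes "k < M" shows "(z k)\<^sup>2 \<le> Q z"
proof -
  have "1 * (z k)\<^sup>2 \<le> wt k * (z k)\<^sup>2" by (intro mult_right_mono) (auto simp: wt_def)
  also have "\<dots> \<le> Q z" unfolding Q_def using assms by (intro member_le_sum) (auto simp: wt_def)
  finally show ?thesis by simp
qed

lemma Z_coord_le: assumes "z \<in> Z" "Q z \<le> Qmax" shows "\<bar>z k\<bar> \<le> sqrt Qmax"
proof (cases "k < M")
  case True
  then show ?thesis using Q_coord[of k z] assms(2) by (intro real_le_rsqrt) simp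
next
  case False
  moreover have "0 \<le> Qmax" by (simp add: Qmax_def)
  ultimately show ?thesis using Z_memD(3)[OF assms(1)] by (simp add: supp_def)
qed

end

section \<open>Bounded Lipschitz functions, uniformly in the smoothing parameter\<close>

definition ulip_with :: "real \<Rightarrow> real \<Rightarrow> (real \<Rightarrow> (nat \<Rightarrow> real) \<Rightarrow> real) \<Rightarrow> bool" where
  "ulip_with c K f \<longleftrightarrow> (\<forall>mu>0. \<forall>z z' e. (\<forall>k. \<bar>z k\<bar> \<le> c \<and> \<bar>z' k\<bar> \<le> c \<and> \<bar>z' k - z k\<bar> \<le> e) \<longrightarrow>
     \<bar>f mu z\<bar> \<le> K \<and> \<bar>f mu z'\<bar> \<le> K \<and> \<bar>f mu z' - f mu z\<bar> \<le> K * e)"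

text \<open>One constant serves as bound and as sup-norm Lipschitz constant on a box, for all
  \<open>mu > 0\<close> at once, so it does not degenerate as \<open>mu\<close> tends to 0.\<close>

definition ulip :: "real \<Rightarrow> (real \<Rightarrow> (nat \<Rightarrow> real) \<Rightarrow> real) \<Rightarrow> bool" where
  "ulip c f \<longleftrightarrow> (\<exists>K\<ge>0. ulip_with c K f)"

lemma ulip_withD:
  assumes "ulip_with c K f" "0 < mu" "\<And>k. \<bar>z k\<bar> \<le> c" "\<And>k. \<bar>z' k\<bar> \<le> c" "\<And>k. \<bar>z' k - z k\<bar> \<le> e"
  shows "\<bar>f mu z\<bar> \<le> K \<and> \<bar>f mu z'\<bar> \<le> K \<and> \<bar>f mu z' - f mu z\<bar> \<le> K * e"
  using assms(1)[unfolded ulip_with_def, rule_format, of mu z z' e] assms(2-) by simp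

lemma ulipI:
  assumes "\<And>mu z z' e. 0 < mu \<Longrightarrow> (\<And>k. \<bar>z k\<bar> \<le> c) \<Longrightarrow> (\<And>k. \<bar>z' k\<bar> \<le> c) \<Longrightarrow>
      (\<And>k. \<bar>z' k - z k\<bar> \<le> e) \<Longrightarrow> \<bar>f mu z\<bar> \<le> K \<and> \<bar>f mu z'\<bar> \<le> K \<and> \<bar>f mu z' - f mu z\<bar> \<le> K * e"
    and "0 \<le> K"
  shows "ulip c f"
proof -
  have "ulip_with c K f" unfolding ulip_with_def by (intro allI impI assms(1)) auto
  then show ?thesis using assms(2) by (auto simp: ulip_def)
qed

lemma ulipE:
  assumes "ulip c f" obtains K where "0 \<le> K" "ulip_with c K f"
  using assms by (auto simp: ulip_def)

lemma ulip_const: "ulip c (\<lambda>mu z. a)"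
proof (rule ulipI[where K = "\<bar>a\<bar>"])
  fix mu e :: real and z z' :: "nat \<Rightarrow> real"
  assume b: "\<And>k. \<bar>z' k - z k\<bar> \<le> e"
  have "0 \<le> \<bar>a\<bar> * e" using order_trans[OF abs_ge_zero b] by simp
  then show "\<bar>a\<bar> \<le> \<bar>a\<bar> \<and> \<bar>a\<bar> \<le> \<bar>a\<bar> \<and> \<bar>a - a\<bar> \<le> \<bar>a\<bar> * e" by simp
qed simp

lemma ulip_coord: "ulip c (\<lambda>mu z. z k)"
proof (rule ulipI[where K = "max 1 c"])
  fix mu e :: real and z z' :: "nat \<Rightarrow> real"
  assume b: "\<And>k. \<bar>z k\<bar> \<le> c" "\<And>k. \<bar>z' k\<bar> \<le> c" "\<And>k. \<bar>z' k - z k\<bar> \<le> e"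
  have "0 \<le> e" using order_trans[OF abs_ge_zero b(3)] .
  then have "1 * e \<le> max 1 c * e" by (intro mult_right_mono) auto
  then show "\<bar>z k\<bar> \<le> max 1 c \<and> \<bar>z' k\<bar> \<le> max 1 c \<and> \<bar>z' k - z k\<bar> \<le> max 1 c * e"
    using b[of k] by auto
qed auto

lemma ulip_add:
  assumes "ulip c f" "ulip c g" shows "ulip c (\<lambda>mu z. f mu z + g mu z)"
proof -
  obtain K where K: "0 \<le> K" "ulip_with c K f"
    using assms(1) by (rule ulipE)
  obtain J where J: "0 \<le> J" "ulip_with c J g"
    using assms(2) by (rule ulipE)
  show ?thesis
  proof (rule ulipI[where K = "K + J"])
    fix mu e :: real and z z' :: "nat \<Rightarrow> real"
    assume b: "0 < mu" "\<And>k. \<bar>z k\<bar> \<le> c" "\<And>k. \<bar>z' k\<bar> \<le> c" "\<And>k. \<bar>z' k - z k\<bar> \<le> e"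
    show "\<bar>f mu z + g mu z\<bar> \<le> K + J \<and> \<bar>f mu z' + g mu z'\<bar> \<le> K + J
      \<and> \<bar>f mu z' + g mu z' - (f mu z + g mu z)\<bar> \<le> (K + J) * e"
      unfolding distrib_right using ulip_withD[where z = z and z' = z', OF K(2) b] ulip_withD[where z = z and z' = z', OF J(2) b] by linarith
  qed (use K J in simp)
qed

text \<open>The product rule is the reason why a bound is carried along with the Lipschitz
  constant.\<close>

lemma ulip_mult:
  assumes "ulip c f" "ulip c g" shows "ulip c (\<lambda>mu z. f mu z * g mu z)"
proof -
  obtain K where K: "0 \<le> K" "ulip_with c K f"
    using assms(1) by (rule ulipE)
  obtain J where J: "0 \<le> J" "ulip_with c J g"
    using assms(2) by (rule ulipE)
  show ?thesis
  proof (rule ulipI[where K = "2 * (K * J)"])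
    fix mu e :: real and z z' :: "nat \<Rightarrow> real"
    assume b: "0 < mu" "\<And>k. \<bar>z k\<bar> \<le> c" "\<And>k. \<bar>z' k\<bar> \<le> c" "\<And>k. \<bar>z' k - z k\<bar> \<le> e"
    note F = ulip_withD[where z = z and z' = z', OF K(2) b] and G = ulip_withD[where z = z and z' = z', OF J(2) b]
    have e: "f mu z' * g mu z' - f mu z * g mu z
        = (f mu z' - f mu z) * g mu z' + f mu z * (g mu z' - g mu z)"
      by (simp add: algebra_simps)
    have "\<bar>(f mu z' - f mu z) * g mu z'\<bar> \<le> K * e * J" "\<bar>f mu z * (g mu z' - g mu z)\<bar> \<le> K * (J * e)"
      "\<bar>f mu z * g mu z\<bar> \<le> K * J" "\<bar>f mu z' * g mu z'\<bar> \<le> K * J"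
      unfolding abs_mult using F G K(1) order_trans[OF abs_ge_zero b(4)] by (auto intro!: mult_mono)
    moreover have "0 \<le> K * J" using K J by simp
    ultimately show "\<bar>f mu z * g mu z\<bar> \<le> 2 * (K * J) \<and> \<bar>f mu z' * g mu z'\<bar> \<le> 2 * (K * J)
      \<and> \<bar>f mu z' * g mu z' - f mu z * g mu z\<bar> \<le> 2 * (K * J) * e"
      unfolding e by (auto simp: mult_ac)
  qed (use K J in simp)
qed

lemma ulip_sum:
  assumes "\<And>i. i \<in> I \<Longrightarrow> ulip c (f i)" shows "ulip c (\<lambda>mu z. \<Sum>i\<in>I. f i mu z)"
  using assms by (induction I rule: infinite_finite_induct) (auto intro: ulip_const ulip_add)

lemma ulip_diff:
  assumes "ulip c f" "ulip c g" shows "ulip c (\<lambda>mu z. f mu z - g mu z)"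
  using ulip_add[OF assms(1) ulip_mult[OF ulip_const[of c "-1"] assms(2)]] by simp

lemma ulip_contract:
  assumes "ulip c f" and h: "\<And>mu a. 0 < mu \<Longrightarrow> \<bar>h mu a\<bar> \<le> \<bar>a\<bar>"
    "\<And>mu a b. 0 < mu \<Longrightarrow> \<bar>h mu a - h mu b\<bar> \<le> \<bar>a - b\<bar>"
  shows "ulip c (\<lambda>mu z. h mu (f mu z))"
proof -
  obtain K where K: "0 \<le> K" "ulip_with c K f"
    using assms(1) by (rule ulipE)
  show ?thesis
  proof (rule ulipI[OF _ K(1)])
    fix mu e :: real and z z' :: "nat \<Rightarrow> real"
    assume b: "0 < mu" "\<And>k. \<bar>z k\<bar> \<le> c" "\<And>k. \<bar>z' k\<bar> \<le> c" "\<And>k. \<bar>z' k - z k\<bar> \<le> e"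
    show "\<bar>h mu (f mu z)\<bar> \<le> K \<and> \<bar>h mu (f mu z')\<bar> \<le> K \<and> \<bar>h mu (f mu z') - h mu (f mu z)\<bar> \<le> K * e"
      using ulip_withD[where z = z and z' = z', OF K(2) b] h(1)[OF b(1)] h(2)[OF b(1)] order_trans by meson
  qed
qed

lemma ulip_pos: "ulip c f \<Longrightarrow> ulip c (\<lambda>mu z. pos (f mu z))"
  by (rule ulip_contract) (auto simp: pos_diff_le, auto simp: pos_def)

lemma ulip_sig: "ulip c f \<Longrightarrow> ulip c (\<lambda>mu z. sig (f mu z) mu)"
proof (rule ulip_contract[where h = "\<lambda>mu a. sig a mu"])
  fix mu a :: real assume mu: "0 < mu"
  have "0 \<le> sig a mu" using mu by (auto simp: sig_def)
  moreover have "pos a \<le> \<bar>a\<bar>" by (simp add: pos_def)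
  ultimately show "\<bar>sig a mu\<bar> \<le> \<bar>a\<bar>" using sig_bounds(1)[OF mu, of a] by linarith
qed (auto intro: sig_diff_le)

lemma DERIV_abs_le:
  fixes f :: "real \<Rightarrow> real"
  assumes "(f has_real_derivative D) (at x)"
    and "\<And>t. \<bar>t - x\<bar> \<le> 1 \<Longrightarrow> \<bar>f t - f x\<bar> \<le> K * \<bar>t - x\<bar>"
  shows "\<bar>D\<bar> \<le> K"
proof (rule tendsto_upperbound)
  show "((\<lambda>t. \<bar>(f t - f x) / (t - x)\<bar>) \<longlongrightarrow> \<bar>D\<bar>) (at x)"
    using assms(1) unfolding has_field_derivative_iff by (rule tendsto_rabs)
  show "\<forall>\<^sub>F t in at x. \<bar>(f t - f x) / (t - x)\<bar> \<le> K"
    unfolding eventually_at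
    by (rule exI[of _ 1]) (use assms(2) in \<open>auto simp: dist_real_def abs_divide divide_le_eq\<close>)
qed simp

context spg_problem
begin

lemma ulip_H: "ulip c (\<lambda>mu z. H z mu)"
  unfolding Htil_def Ftil_def Ptil_def pre1_def pre2_def blocks power2_eq_square
  by (intro ulip_add ulip_diff ulip_mult ulip_sum ulip_const ulip_coord ulip_pos ulip_sig)

lemma ulip_R: "ulip c (\<lambda>mu. R)"
  unfolding Rfun_def blocks power2_eq_square
  by (intro ulip_add ulip_mult ulip_sum ulip_const ulip_coord)

text \<open>Compared with staying at \<open>z\<close>, the quadratic term of the subproblem is at
  most linear in the step length, which is therefore \<open>O(1 / L)\<close>. The smoothed objective
  is Lipschitz on the bounded set, with a constant independent of \<open>mu\<close>.\<close>

lemma step_increase: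
  obtains D where "0 \<le> D"
    "\<And>mu L z z'. 0 < mu \<Longrightarrow> 0 < L \<Longrightarrow> z \<in> Z \<Longrightarrow> z' \<in> Z \<Longrightarrow> Q z \<le> Qmax \<Longrightarrow> Q z' \<le> Qmax \<Longrightarrow>
      subobj N N0 N1 X lam1 lam2 beta z mu L z' \<le> subobj N N0 N1 X lam1 lam2 beta z mu L z \<Longrightarrow>
      Otil N N0 N1 X lam1 lam2 beta z' mu - Otil N N0 N1 X lam1 lam2 beta z mu \<le> D / L"
proof -
  define c where "c = sqrt Qmax"
  \<comment> \<open>The margin 1 leaves room to vary one coordinate of \<open>z\<close>, which
    bounds the partial derivatives by \<open>K\<close>.\<close>
  obtain K where K: "0 \<le> K" "ulip_with (c + 1) K (\<lambda>mu z. H z mu)"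
    using ulip_H[of "c + 1"] by (rule ulipE)
  obtain J where J: "0 \<le> J" "ulip_with (c + 1) J (\<lambda>mu. R)"
    using ulip_R[of "c + 1"] by (rule ulipE)
  define B where "B = real M * K + J"
  have B: "0 \<le> B" using K J by (simp add: B_def)
  show ?thesis
  proof (rule that[of "2 * B * (K + J)"])
    show "0 \<le> 2 * B * (K + J)" using B K J by simp
    fix mu L z z' assume mu: "0 < mu" and L: "0 < L" and z: "z \<in> Z" and z': "z' \<in> Z"
      and Qz: "Q z \<le> Qmax" "Q z' \<le> Qmax"
      and opt: "subobj N N0 N1 X lam1 lam2 beta z mu L z' \<le> subobj N N0 N1 X lam1 lam2 beta z mu L z"
    let ?d = "\<lambda>k. z' k - z k"
    define e where "e = sqrt (sqnorm M ?d)"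
    have sq0: "0 \<le> sqnorm M ?d" by (simp add: sqnorm_def sum_nonneg)
    then have e0: "0 \<le> e" and e2: "sqnorm M ?d = e * e" by (simp_all add: e_def)
    have zb: "\<bar>z k\<bar> \<le> c" and zb': "\<bar>z' k\<bar> \<le> c" for k
      using Z_coord_le[OF z Qz(1)] Z_coord_le[OF z' Qz(2)] by (simp_all add: c_def)
    then have zb1: "\<bar>z k\<bar> \<le> c + 1" and zb1': "\<bar>z' k\<bar> \<le> c + 1" for k
      by (simp_all add: add_increasing2)
    have de: "\<bar>?d k\<bar> \<le> e" for k
    proof (cases "k < M")
      case True
      then have "(?d k)\<^sup>2 \<le> sqnorm M ?d" unfolding sqnorm_def by (intro member_le_sum) auto
      then show ?thesis unfolding e_def by (intro real_le_rsqrt) simp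
    next
      case False
      then show ?thesis using e0 Z_memD(3)[OF z] Z_memD(3)[OF z'] by (simp add: supp_def)
    qed
    have g: "\<bar>gH z mu i\<bar> \<le> K" if "i < M" for i
    proof -
      have "gH z mu i = dH z mu (unitv i)"
        using that DERIV_imp_deriv[OF DERIV_H_coord[OF mu]] by (simp add: gradH_def)
      moreover have "\<bar>dH z mu (unitv i)\<bar> \<le> K"
      proof (rule DERIV_abs_le[OF DERIV_H_coord[OF mu]])
        fix t assume t: "\<bar>t - z i\<bar> \<le> 1"
        have "\<bar>t\<bar> \<le> c + 1" using t zb[of i] by linarith
        then have "\<bar>(z(i := t)) k\<bar> \<le> c + 1" "\<bar>(z(i := t)) k - z k\<bar> \<le> \<bar>t - z i\<bar>" for k
          using zb1[of k] by auto
        then show "\<bar>H (z(i := t)) mu - H (z(i := z i)) mu\<bar> \<le> K * \<bar>t - z i\<bar>"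
          using ulip_withD[OF K(2) mu, of z "z(i := t)" "\<bar>t - z i\<bar>"] zb1 by simp
      qed
      ultimately show ?thesis by simp
    qed
    have "\<bar>innerz M (gH z mu) ?d\<bar> \<le> (\<Sum>i<M. \<bar>gH z mu i * ?d i\<bar>)"
      unfolding innerz_def by (rule sum_abs)
    also have "\<dots> \<le> (\<Sum>i<M. K * e)"
      unfolding abs_mult using g de K(1) by (intro sum_mono mult_mono) auto
    finally have inn: "- innerz M (gH z mu) ?d \<le> real M * K * e" by simp
    have "R z - R z' \<le> J * e" using ulip_withD[where z = z and z' = z', OF J(2) mu zb1 zb1' de] by linarith
    moreover have "innerz M (gH z mu) ?d + R z' + L / 2 * sqnorm M ?d \<le> R z"
      using opt by (simp add: subobj_def innerz_def sqnorm_def)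
    ultimately have "L / 2 * (e * e) \<le> B * e" using inn unfolding e2 B_def by (simp add: distrib_right)
    then have "L / 2 * e \<le> B" using e0 B by (cases "e = 0") (auto simp: mult.assoc[symmetric])
    then have eL: "e \<le> 2 * B / L" using L by (simp add: field_simps)
    have "Otil N N0 N1 X lam1 lam2 beta z' mu - Otil N N0 N1 X lam1 lam2 beta z mu \<le> (K + J) * e"
      using ulip_withD[where z = z and z' = z', OF J(2) mu zb1 zb1' de] ulip_withD[where z = z and z' = z', OF K(2) mu zb1 zb1' de] unfolding Otil_def distrib_right by linarith
    also have "\<dots> \<le> (K + J) * (2 * B / L)" using eL K J by (intro mult_left_mono) auto
    finally show "Otil N N0 N1 X lam1 lam2 beta z' mu - Otil N N0 N1 X lam1 lam2 beta z mu \<le> 2 * B * (K + J) / L"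
      by (simp add: mult_ac)
  qed
qed

text \<open>\<open>pos\<close> and \<open>sig\<close> differ by at most \<open>mu / 2\<close>
  everywhere, whence \<open>C\<close> is independent of \<open>z\<close>. In \<open>Ftil\<close>
  only the term linear in the data is smoothed, so the other parts of the expanded square
  cancel.\<close>

lemma smoothing_gap:
  obtains C where "0 \<le> C" "\<And>z mu. 0 < mu \<Longrightarrow>
    \<bar>Otil N N0 N1 X lam1 lam2 beta z mu - Ofun N N0 N1 X lam1 lam2 beta z\<bar> \<le> C * mu"
proof -
  define C where "C = 2 / real N * (\<Sum>n<N. \<Sum>j<N0. \<bar>X j n\<bar> * (1 / 2)) + beta * (\<Sum>n<N. \<Sum>i<N1. 1 / 2)"
  show ?thesis
  proof (rule that[of C])
    show "0 \<le> C" unfolding C_def using beta by (intro add_nonneg_nonneg mult_nonneg_nonneg sum_nonneg) auto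
    fix z and mu :: real assume mu: "0 < mu"
    have gap: "\<bar>pos a - sig a mu\<bar> \<le> 1 / 2 * mu" for a using sig_bounds[OF mu, of a] by simp
    have F: "Ftil N N0 N1 X z mu - Ffun N N0 N1 X z
        = 2 / real N * (\<Sum>n<N. \<Sum>j<N0. X j n * (pos (out z j n) - sig (out z j n) mu))"
    proof -
      have "frob2 N N0 X = (\<Sum>n<N. \<Sum>j<N0. (X j n)\<^sup>2)" unfolding frob2_def by (rule sum.swap)
      then show ?thesis
        by (simp add: Ftil_def Ffun_def power2_diff sum.distrib sum_subtractf sum_distrib_left algebra_simps)
    qed
    have P: "Ptil N N0 N1 X beta z mu - Pfun N N0 N1 X beta z
        = beta * (\<Sum>n<N. \<Sum>i<N1. pos (hid z i n) - sig (hid z i n) mu)"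
      by (simp add: Ptil_def Pfun_def sum_subtractf algebra_simps)
    have "\<bar>\<Sum>n<N. \<Sum>j<N0. X j n * (pos (out z j n) - sig (out z j n) mu)\<bar>
        \<le> (\<Sum>n<N. \<Sum>j<N0. \<bar>X j n * (pos (out z j n) - sig (out z j n) mu)\<bar>)"
      by (intro order_trans[OF sum_abs] sum_mono order_trans[OF sum_abs]) simp
    also have "\<dots> \<le> (\<Sum>n<N. \<Sum>j<N0. \<bar>X j n\<bar> * (1 / 2 * mu))"
      unfolding abs_mult by (intro sum_mono mult_left_mono gap) auto
    finally have F': "\<bar>2 / real N * (\<Sum>n<N. \<Sum>j<N0. X j n * (pos (out z j n) - sig (out z j n) mu))\<bar>
        \<le> 2 / real N * (\<Sum>n<N. \<Sum>j<N0. \<bar>X j n\<bar> * (1 / 2 * mu))"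
      using mult_left_mono[of _ _ "2 / real N"] by (simp only: abs_mult[of "2 / real N"]) simp
    have "\<bar>\<Sum>n<N. \<Sum>i<N1. pos (hid z i n) - sig (hid z i n) mu\<bar>
        \<le> (\<Sum>n<N. \<Sum>i<N1. \<bar>pos (hid z i n) - sig (hid z i n) mu\<bar>)"
      by (intro order_trans[OF sum_abs] sum_mono order_trans[OF sum_abs]) simp
    also have "\<dots> \<le> (\<Sum>n<N. \<Sum>i<N1. 1 / 2 * mu)" by (intro sum_mono gap)
    finally have P': "\<bar>beta * (\<Sum>n<N. \<Sum>i<N1. pos (hid z i n) - sig (hid z i n) mu)\<bar>
        \<le> beta * (\<Sum>n<N. \<Sum>i<N1. 1 / 2 * mu)"
      unfolding abs_mult[of beta] using beta by (auto intro!: mult_left_mono)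
    have "C * mu = 2 / real N * (\<Sum>n<N. \<Sum>j<N0. \<bar>X j n\<bar> * (1 / 2 * mu)) + beta * (\<Sum>n<N. \<Sum>i<N1. 1 / 2 * mu)"
    proof -
      have "(\<Sum>n<N. \<Sum>j<N0. \<bar>X j n\<bar> * (1 / 2 * mu)) = (\<Sum>n<N. \<Sum>j<N0. \<bar>X j n\<bar> * (1 / 2)) * mu"
        by (simp add: sum_distrib_right)
      then show ?thesis by (simp add: C_def distrib_right)
    qed
    then show "\<bar>Otil N N0 N1 X lam1 lam2 beta z mu - Ofun N N0 N1 X lam1 lam2 beta z\<bar> \<le> C * mu"
      using F P F' P' unfolding Otil_def Ofun_def Htil_def by linarith
  qed
qed

lemma Rfun_le_Ofun:
  assumes "z \<in> Z" shows "lam1 * sumV z + lam2 * normW z \<le> Ofun N N0 N1 X lam1 lam2 beta z"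
proof -
  have "0 \<le> Ffun N N0 N1 X z" unfolding Ffun_def by (intro mult_nonneg_nonneg sum_nonneg) auto
  moreover have "0 \<le> Pfun N N0 N1 X beta z"
    unfolding Pfun_def using V_nonneg[OF assms] beta by (intro mult_nonneg_nonneg sum_nonneg) auto
  ultimately show ?thesis by (simp add: Ofun_def Rfun_def sumV_def normW_def)
qed

end

text \<open>\<open>p k\<close> is the smoothed objective at the new iterate with the old smoothing parameter.\<close>
lemma spg_sequences_converge:
  fixes mu L a p v :: "nat \<Rightarrow> real"
  assumes pos: "0 < mu 0" "0 < L 0" and tau: "0 < tau1" "tau1 < 1" "0 < tau2" "1 \<le> tau3" "1 \<le> tau1 * tau3"
    and upd: "\<And>k. (mu (Suc k), L (Suc k)) =
      (if p k - a k < - tau2 * mu k / L k then (mu k, L k) else (tau1 * mu k, tau3 * L k))"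
    and incr: "\<And>k. p k - a k \<le> D / L k" "0 \<le> D"
    and gap: "\<And>k. \<bar>a k - v k\<bar> \<le> C * mu k" "\<And>k. \<bar>p k - v (Suc k)\<bar> \<le> C * mu k" "0 \<le> C"
    and same: "\<And>k. mu (Suc k) = mu k \<Longrightarrow> a (Suc k) = p k"
    and nonneg: "\<And>k. 0 \<le> v k"
  shows "mu \<longlonglongrightarrow> 0 \<and> convergent v \<and> convergent a \<and> lim a = lim v"
proof -
  have cases: "(p k - a k < - tau2 * mu k / L k \<and> mu (Suc k) = mu k \<and> L (Suc k) = L k)
      \<or> (mu (Suc k) = tau1 * mu k \<and> L (Suc k) = tau3 * L k)" for k
    using upd[of k] by (auto split: if_splits)
  \<comment> \<open>Since \<open>tau1 * tau3 >= 1\<close>, the product \<open>mu k * L k\<close>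
    never decreases, so \<open>1 / L k\<close> is at most a fixed multiple of
    \<open>mu k\<close>.\<close>
  have muL: "0 < mu k \<and> 0 < L k \<and> mu 0 * L 0 \<le> mu k * L k" for k
  proof (induction k)
    case (Suc k)
    have "1 * (mu k * L k) \<le> tau1 * tau3 * (mu k * L k)" using Suc tau by (intro mult_right_mono) auto
    with Suc have "mu 0 * L 0 \<le> (tau1 * mu k) * (tau3 * L k)" by (simp only: mult_ac) linarith
    with Suc cases[of k] tau show ?case by auto
  qed (use pos in auto)
  have mu_le: "mu (Suc k) \<le> mu k" for k
    using cases[of k] muL[of k] tau by (auto simp: mult_le_cancel_right1)
  define c where "c = mu 0 * L 0"
  have c: "0 < c" using pos by (simp add: c_def)
  \<comment> \<open>When \<open>mu\<close> shrinks it drops by \<open>(1 - tau1) * mu k\<close>,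
    while \<open>a\<close> grows by at most \<open>(D / c + 2 * C) * mu k\<close>. This
    \<open>K\<close> makes \<open>a k + K * mu k\<close> nonincreasing.\<close>
  define K where "K = (D / c + 2 * C) / (1 - tau1)"
  have K0: "0 \<le> K" using incr(2) c gap(3) tau by (simp add: K_def)
  have desc: "a (Suc k) - a k \<le> K * (mu k - mu (Suc k))" for k
    using cases[of k]
  proof (elim disjE conjE)
    assume h: "p k - a k < - tau2 * mu k / L k" "mu (Suc k) = mu k"
    have "0 \<le> tau2 * mu k / L k" using muL[of k] tau by simp
    then show ?thesis using h same[of k] by simp
  next
    assume h: "mu (Suc k) = tau1 * mu k"
    have "c \<le> mu k * L k" using muL[of k] by (simp add: c_def)
    then have "D * c \<le> D * (mu k * L k)" using incr(2) by (intro mult_left_mono)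
    then have "D / L k \<le> D / c * mu k" using muL[of k] c by (simp add: field_simps)
    moreover have "C * mu (Suc k) \<le> C * mu k" using mu_le gap(3) by (intro mult_left_mono)
    ultimately have "a (Suc k) - a k \<le> D / c * mu k + 2 * (C * mu k)"
      using incr(1)[of k] gap(1)[of "Suc k"] gap(2)[of k] by linarith
    also have "\<dots> = K * (mu k - mu (Suc k))" using tau by (simp add: K_def h field_simps)
    finally show ?thesis .
  qed
  have dmu: "decseq mu" using mu_le by (simp add: decseq_Suc_iff)
  obtain l where l: "mu \<longlonglongrightarrow> l" "\<And>k. l \<le> mu k"
    using decseq_convergent[OF dmu, of 0] muL less_imp_le by metis
  have "0 \<le> l" using l(1) muL by (meson LIMSEQ_le_const less_imp_le)
  have ds: "decseq (\<lambda>k. a k + K * mu k)"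
    using desc by (simp add: decseq_Suc_iff algebra_simps)
  have lower: "- (C * mu 0) \<le> a k + K * mu k" for k
  proof -
    have "mu k \<le> mu 0" using dmu by (simp add: decseqD)
    then have "C * mu k \<le> C * mu 0" using gap(3) by (intro mult_left_mono)
    moreover have "0 \<le> K * mu k" using K0 muL[of k] by simp
    ultimately show ?thesis using gap(1)[of k] nonneg[of k] by linarith
  qed
  obtain s where s: "(\<lambda>k. a k + K * mu k) \<longlonglongrightarrow> s"
    using decseq_convergent[OF ds, of "- (C * mu 0)"] lower by metis
  have "l = 0"
  proof (rule ccontr)
    assume "l \<noteq> 0"
    with \<open>0 \<le> l\<close> have l0: "0 < l" by simp
    then have "l < l / tau1" using tau by (simp add: field_simps)
    \<comment> \<open>Once \<open>mu k < l / tau1\<close>, another shrinking would push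
      \<open>mu\<close> below its limit \<open>l\<close>. From then on \<open>mu\<close> and
      \<open>L\<close> are frozen and every step lowers the objective by at least a fixed
      \<open>d\<close>, contradicting convergence.\<close>
    then have "\<forall>\<^sub>F k in sequentially. mu k < l / tau1" by (rule order_tendstoD(2)[OF l(1)])
    then obtain k0 where k0: "\<And>k. k0 \<le> k \<Longrightarrow> mu k < l / tau1" by (auto simp: eventually_sequentially)
    have good: "p k - a k < - tau2 * mu k / L k \<and> mu (Suc k) = mu k \<and> L (Suc k) = L k" if "k0 \<le> k" for k
    proof -
      have "tau1 * mu k < l" using k0[OF that] tau by (simp add: field_simps)
      then show ?thesis using cases[of k] l(2)[of "Suc k"] by auto
    qed
    have const: "mu (k0 + n) = mu k0 \<and> L (k0 + n) = L k0" for n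
      by (induction n) (use good in auto)
    define d where "d = tau2 * mu k0 / L k0"
    have d: "0 < d" using tau muL[of k0] by (simp add: d_def)
    have "a (Suc (k0 + n)) + K * mu (Suc (k0 + n)) - (a (k0 + n) + K * mu (k0 + n)) \<le> - d" for n
      using good[of "k0 + n"] same[of "k0 + n"] const[of n] by (simp add: d_def)
    moreover have "(\<lambda>n. a (Suc (k0 + n)) + K * mu (Suc (k0 + n)) - (a (k0 + n) + K * mu (k0 + n))) \<longlonglongrightarrow> s - s"
    proof (rule tendsto_diff)
      show "(\<lambda>n. a (k0 + n) + K * mu (k0 + n)) \<longlonglongrightarrow> s"
        using LIMSEQ_ignore_initial_segment[OF s, of k0] by (simp add: add.commute)
      show "(\<lambda>n. a (Suc (k0 + n)) + K * mu (Suc (k0 + n))) \<longlonglongrightarrow> s"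
        using LIMSEQ_ignore_initial_segment[OF s, of "Suc k0"] by (simp add: add.commute)
    qed
    ultimately have "s - s \<le> - d" by (intro LIMSEQ_le_const2) auto
    then show False using d by simp
  qed
  then have mu0: "mu \<longlonglongrightarrow> 0" using l by simp
  have "(\<lambda>k. a k + K * mu k - K * mu k) \<longlonglongrightarrow> s - K * 0"
    by (intro tendsto_diff s tendsto_mult tendsto_const mu0)
  then have a: "a \<longlonglongrightarrow> s" by simp
  have "(\<lambda>k. a k - v k) \<longlonglongrightarrow> 0"
  proof (rule Lim_null_comparison)
    show "\<forall>\<^sub>F k in sequentially. norm (a k - v k) \<le> C * mu k" using gap(1) by simp
    show "(\<lambda>k. C * mu k) \<longlonglongrightarrow> 0" using tendsto_mult_left[OF mu0, of C] by simp
  qed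
  from tendsto_diff[OF a this] have v: "v \<longlonglongrightarrow> s" by simp
  show ?thesis using mu0 a v convergentI limI by metis
qed

theorem theorem3p1:
  fixes N N0 N1 :: nat
    and X :: "nat \<Rightarrow> nat \<Rightarrow> real"
    and lam1 lam2 beta theta tau1 tau2 tau3 LH LG :: real
    and z :: "nat \<Rightarrow> nat \<Rightarrow> real"
    and mu L :: "nat \<Rightarrow> real"
  assumes dims: "0 < N" "0 < N0" "0 < N1"
    and params: "0 < lam1" "0 < lam2" "0 < beta"
    and theta: "theta > frob2 N N0 X / real N"
    and LH: "\<And>z1 m1 z2 m2.
        z1 \<in> Omega_theta N N0 N1 X lam1 lam2 beta theta \<inter> Zset N N0 N1 X lam1 lam2 theta \<Longrightarrow>
        z2 \<in> Omega_theta N N0 N1 X lam1 lam2 beta theta \<inter> Zset N N0 N1 X lam1 lam2 theta \<Longrightarrow>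
        m1 \<in> {0<..<1} \<Longrightarrow> m2 \<in> {0<..<1} \<Longrightarrow>
        \<bar>m1 * Htil N N0 N1 X beta z1 m1 - m2 * Htil N N0 N1 X beta z2 m2\<bar>
          \<le> LH * distzm (dimz N N0 N1) z1 m1 z2 m2"
    and LG: "\<And>z1 m1 z2 m2.
        z1 \<in> supp (dimz N N0 N1) \<Longrightarrow> z2 \<in> supp (dimz N N0 N1) \<Longrightarrow>
        (\<forall>i<dimz N N0 N1. \<bar>z1 i\<bar> \<le> max (alpha N N0 N1 X lam1 lam2 theta) (2 * eta N0 N1 lam1 lam2 theta)) \<Longrightarrow>
        (\<forall>i<dimz N N0 N1. \<bar>z2 i\<bar> \<le> max (alpha N N0 N1 X lam1 lam2 theta) (2 * eta N0 N1 lam1 lam2 theta)) \<Longrightarrow>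
        m1 \<in> {0<..<1} \<Longrightarrow> m2 \<in> {0<..<1} \<Longrightarrow>
        sqrt (sqnorm (dimz N N0 N1)
               (\<lambda>i. m1 * gradH N N0 N1 X beta z1 m1 i - m2 * gradH N N0 N1 X beta z2 m2 i))
          \<le> LG * distzm (dimz N N0 N1) z1 m1 z2 m2"
    and z0: "z 0 \<in> Zset N N0 N1 X lam1 lam2 theta"
    and mu0: "0 < mu 0" "mu 0 < 1"
    and taus: "0 < tau1" "tau1 < 1" "0 < tau2" "1 \<le> tau3"
    and L0: "1 \<le> L 0"
    and step_min: "\<And>k. z (Suc k) \<in> Zset N N0 N1 X lam1 lam2 theta \<and>
        (\<forall>w\<in>Zset N N0 N1 X lam1 lam2 theta.
           subobj N N0 N1 X lam1 lam2 beta (z k) (mu k) (L k) (z (Suc k))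
             \<le> subobj N N0 N1 X lam1 lam2 beta (z k) (mu k) (L k) w)"
    and step_upd: "\<And>k. (mu (Suc k), L (Suc k)) =
        (if Otil N N0 N1 X lam1 lam2 beta (z (Suc k)) (mu k) - Otil N N0 N1 X lam1 lam2 beta (z k) (mu k)
              < - tau2 * mu k / L k
         then (mu k, L k) else (tau1 * mu k, tau3 * L k))"
    and O0: "Ofun N N0 N1 X lam1 lam2 beta (z 0) < theta"
    and tau13: "tau1 * tau3 \<ge> 1"
    and muL0: "mu 0 * L 0 \<ge> max
        (6 * lam2 * real N1 * real N0
          + 2 / eta N0 N1 lam1 lam2 theta * (real (dimz N N0 N1) * LH + lam1 * real N1 * real N))
        (8 * lam2 + LG)"
  shows "mu \<longlonglongrightarrow> 0
    \<and> convergent (\<lambda>k. Ofun N N0 N1 X lam1 lam2 beta (z k))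
    \<and> convergent (\<lambda>k. Otil N N0 N1 X lam1 lam2 beta (z k) (mu k))
    \<and> lim (\<lambda>k. Otil N N0 N1 X lam1 lam2 beta (z k) (mu k))
         = lim (\<lambda>k. Ofun N N0 N1 X lam1 lam2 beta (z k))"
proof -
  interpret spg_problem N N0 N1 X beta lam1 lam2 theta
    by unfold_locales (use dims params theta in auto)
  have need: "3 / 4 * ((9 / 4 + real N1 + 2 * real N0) * (radius\<^sup>2 / real N) + 2) \<le> 8 * lam2 + LG"
    by (rule step_constant, rule LG) (simp_all add: radius_def)
  \<comment> \<open>The assumption bounds \<open>mu 0 * L 0\<close> from below;
    \<open>mu 0 < 1\<close> transfers the bound to \<open>L 0\<close>, and \<open>L\<close> never
    decreases.\<close>
  have "mu 0 * L 0 \<le> 1 * L 0" using mu0 L0 by (intro mult_right_mono) auto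
  with need muL0 have L0': "3 / 4 * ((9 / 4 + real N1 + 2 * real N0) * (radius\<^sup>2 / real N) + 2) \<le> L 0"
    by simp
  have upd: "mu (Suc k) = mu k \<and> L (Suc k) = L k \<or> mu (Suc k) = tau1 * mu k \<and> L (Suc k) = tau3 * L k" for k
    using step_upd[of k] by (auto split: if_splits)
  have pos: "0 < mu k \<and> L 0 \<le> L k" for k
  proof (induction k)
    case (Suc k)
    have "1 * L k \<le> tau3 * L k" using Suc L0 taus by (intro mult_right_mono) auto
    then show ?case using Suc upd[of k] taus by auto
  qed (use mu0 in auto)
  have Lpos: "0 < L k" for k using pos[of k] L0 by linarith
  have inZ: "z k \<in> Z" for k using z0 step_min by (cases k) auto
  have bounded: "Q (z k) \<le> Qmax" for k
  proof (induction k)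
    case 0
    \<comment> \<open>The regularizer is below \<open>theta\<close> initially; counting its W term
      twice still gives less than \<open>3 * theta\<close>.\<close>
    have "lam1 * sumV (z 0) + lam2 * normW (z 0) < theta" using Rfun_le_Ofun[OF z0] O0 by linarith
    moreover have "0 \<le> lam1 * sumV (z 0)" using sumV_nonneg[OF z0] params by simp
    ultimately show ?case using theta_pos by (intro Q_le_Qmax[OF z0]) linarith
  next
    case (Suc k)
    show ?case
      by (rule Qmax_invariant[where mu = "mu k" and L = "L k" and z = "z k", OF _ Lpos inZ Suc inZ])
        (use pos[of k] step_min[of k] L0' in auto)
  qed
  obtain D where D: "0 \<le> D" "\<And>mu L z z'. 0 < mu \<Longrightarrow> 0 < L \<Longrightarrow> z \<in> Z \<Longrightarrow> z' \<in> Z \<Longrightarrow> Q z \<le> Qmax \<Longrightarrow> Q z' \<le> Qmax \<Longrightarrow>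
      subobj N N0 N1 X lam1 lam2 beta z mu L z' \<le> subobj N N0 N1 X lam1 lam2 beta z mu L z \<Longrightarrow>
      Otil N N0 N1 X lam1 lam2 beta z' mu - Otil N N0 N1 X lam1 lam2 beta z mu \<le> D / L"
    using step_increase by metis
  obtain C where C: "0 \<le> C" "\<And>z mu. 0 < mu \<Longrightarrow>
      \<bar>Otil N N0 N1 X lam1 lam2 beta z mu - Ofun N N0 N1 X lam1 lam2 beta z\<bar> \<le> C * mu"
    using smoothing_gap by metis
  show ?thesis
  proof (rule spg_sequences_converge[where p = "\<lambda>k. Otil N N0 N1 X lam1 lam2 beta (z (Suc k)) (mu k)"
        and a = "\<lambda>k. Otil N N0 N1 X lam1 lam2 beta (z k) (mu k)"
        and v = "\<lambda>k. Ofun N N0 N1 X lam1 lam2 beta (z k)" and C = C and D = D and L = L])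
    show "Otil N N0 N1 X lam1 lam2 beta (z (Suc k)) (mu k) - Otil N N0 N1 X lam1 lam2 beta (z k) (mu k) \<le> D / L k" for k
      using pos[of k] Lpos inZ bounded step_min[of k] by (intro D(2)) auto
    show "0 \<le> Ofun N N0 N1 X lam1 lam2 beta (z k)" for k
    proof -
      have "0 \<le> lam1 * sumV (z k) + lam2 * normW (z k)"
        using sumV_nonneg[OF inZ] norms_nonneg params by simp
      then show ?thesis using Rfun_le_Ofun[OF inZ[of k]] by linarith
    qed
  qed (use mu0 Lpos taus tau13 step_upd C D(1) pos in auto)
qed

end
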